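(* Let $R=\begin{pmatrix}0&1\\1&0\end{pmatrix}$. For any $S=\begin{pmatrix} a & b\\ c& d\end{pmatrix}\in GL_2(\mathbb{Z})$, the family $\{G_n^{S,RSR}\}_{n\ge2}$ is an expander family if and only if $(a+d)(b+c)\neq 0$.
   Context: For $S,T\in GL_2(\mathbb{Z})$ and $n\ge 2$, $G_n^{S,T}=(V_n,E_n^{S,T})$ is the undirected graph with vertex set $V_n=(\mathbb{Z}/n\mathbb{Z})^2$ in which every $(x,y)\in V_n$ is joined by an edge to each of $(x\pm1,y)$, $(x,y\pm1)$, $S(x,y)$, $S^{-1}(x,y)$, $T(x,y)$, $T^{-1}(x,y)$ (arithmetic modulo $n$). For a finite graph $G=(V,E)$, $\lambda_2(G)$ is the minimum of $\frac{\sum_{\{u,v\}\in E}|f(u)-f(v)|^2}{\sum_{u\in V}|f(u)|^2}$ over nonzero $f:V\to\mathbb{C}$ with $\sum_{u\in V}f(u)=0$. An infinite family $\{G_n\}$ of finite graphs with uniformly bounded degrees is an expander family if there is a constant $c>0$ with $\lambda_2(G_n)\ge c$ for all $n$. *)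

theory Defs
  imports "HOL-Analysis.Analysis" "HOL-Library.Uprod"
begin

text \<open>A graph is a pair of a vertex set and a set of undirected edges. Edges are unordered pairs;
  loops \<^term>\<open>Upair u u\<close> are allowed, parallel edges are not.\<close>

type_synonym 'a ugraph = "'a set \<times> 'a uprod set"

definition finite_ugraph :: "'a ugraph \<Rightarrow> bool" where
  "finite_ugraph G \<longleftrightarrow> finite (fst G) \<and> (\<forall>e\<in>snd G. set_uprod e \<subseteq> fst G)"

definition ugraph_degree :: "'a ugraph \<Rightarrow> 'a \<Rightarrow> nat" where
  "ugraph_degree G v = card {e \<in> snd G. v \<in> set_uprod e}"

lift_definition edge_energy :: "('a \<Rightarrow> complex) \<Rightarrow> 'a uprod \<Rightarrow> real"
  is "\<lambda>f (u, v). (cmod (f u - f v))\<^sup>2"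
  by (auto simp: norm_minus_commute)

lemma edge_energy_Upair [simp]: "edge_energy f (Upair u v) = (cmod (f u - f v))\<^sup>2"
  by transfer simp

text \<open>For a finite graph with at least two vertices the set below is nonempty and its infimum is
  attained (by homogeneity and compactness of the unit sphere), so it is the minimum. Only the
  values of \<^term>\<open>f\<close> on the vertex set matter.\<close>

definition lambda2 :: "'a ugraph \<Rightarrow> real" where
  "lambda2 G = Inf {(\<Sum>e\<in>snd G. edge_energy f e) / (\<Sum>u\<in>fst G. (cmod (f u))\<^sup>2) | f.
     (\<exists>u\<in>fst G. f u \<noteq> 0) \<and> (\<Sum>u\<in>fst G. f u) = 0}"

definition expander_family :: "nat set \<Rightarrow> (nat \<Rightarrow> 'a ugraph) \<Rightarrow> bool" where
  "expander_family I G \<longleftrightarrow>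
     infinite I \<and>
     (\<forall>n\<in>I. finite_ugraph (G n)) \<and>
     (\<exists>D. \<forall>n\<in>I. \<forall>v\<in>fst (G n). ugraph_degree (G n) v \<le> D) \<and>
     (\<exists>c>0. \<forall>n\<in>I. lambda2 (G n) \<ge> c)"

text \<open>Residue classes modulo \<^term>\<open>n\<close> are represented by \<open>0, \<dots>, n - 1\<close>.\<close>

definition reduce_mod :: "nat \<Rightarrow> int^2 \<Rightarrow> int^2" where
  "reduce_mod n v = (\<chi> i. v $ i mod int n)"

definition torus_vertices :: "nat \<Rightarrow> (int^2) set" where
  "torus_vertices n = {v. \<forall>i. v $ i \<in> {0..<int n}}"

text \<open>Over the integers, \<^term>\<open>invertible S\<close> says that \<^term>\<open>S\<close> has a two-sided integer inverse,
  i.e. that \<^term>\<open>S\<close> lies in \<open>GL\<^sub>2(\<int>)\<close>. Matrices act on column vectors.\<close>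

definition torus_neighbours :: "int^2^2 \<Rightarrow> int^2^2 \<Rightarrow> int^2 \<Rightarrow> (int^2) set" where
  "torus_neighbours S T v =
     {v + vector [1, 0], v - vector [1, 0], v + vector [0, 1], v - vector [0, 1],
      S *v v, matrix_inv S *v v, T *v v, matrix_inv T *v v}"

definition torus_graph :: "int^2^2 \<Rightarrow> int^2^2 \<Rightarrow> nat \<Rightarrow> (int^2) ugraph" where
  "torus_graph S T n =
     (torus_vertices n,
      {Upair v (reduce_mod n w) | v w. v \<in> torus_vertices n \<and> w \<in> torus_neighbours S T v})"

end

theory Submission
  imports Defs
begin

text \<open>Write \<open>t = a + d\<close>, \<open>s = b + c\<close>, \<open>T = R S R\<close>. Suppose \<open>t s \<noteq> 0\<close>. Then \<open>M = S T\<close> (if \<open>det S = 1\<close>) or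
  \<open>M = S S\<close> (if \<open>det S = -1\<close>) has determinant \<open>1\<close>, trace \<open>s\<^sup>2 + 2\<close> or \<open>t\<^sup>2 + 2\<close>, hence is hyperbolic, and its
  off-diagonal entries add up to \<open>t s\<close>; this makes the eigenlines of \<open>M\<close> and \<open>R M R\<close> disjoint. Hence
  the transposes of \<open>M\<close> and \<open>R M R\<close> have bounded Lyapunov functions on the plane whose increments add
  up to at least a positive constant. On the Fourier side, a function with small energy would carry
  a mass on \<open>\<int>\<^sup>2 - {0}\<close> near \<open>0\<close> that is almost invariant under both matrices, which the Lyapunov
  functions forbid. If \<open>t s = 0\<close>, then up to sign \<open>T\<close> is the inverse of \<open>S\<close>, or both \<open>S\<close> and \<open>T\<close> are
  involutions, and averaging a slow cosine wave along a long stretch of the cyclic or dihedral group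
  they generate yields test functions with arbitrarily small Rayleigh quotient.\<close>

subsection \<open>Fourier analysis on the discrete torus\<close>

lemma matrix_vector_mult_2:
  fixes M :: "int^2^2"
  shows "(M *v v) $ i = M $ i $ 1 * v $ 1 + M $ i $ 2 * v $ 2"
  by (simp add: matrix_vector_mult_def sum_2)

lemma reduce_mod_nth [simp]: "reduce_mod n v $ i = v $ i mod int n"
  by (simp add: reduce_mod_def)

lemma reduce_mod_idem [simp]: "reduce_mod n (reduce_mod n v) = reduce_mod n v"
  by (simp add: vec_eq_iff)

lemma mod_lincomb: "(p * (x mod m) + q * (y mod m)) mod m = (p * x + q * y) mod m"
  for p q x y m :: int
  by (metis mod_add_eq mod_mult_right_eq)

lemma reduce_mod_mult: "reduce_mod n (M *v reduce_mod n v) = reduce_mod n (M *v v)"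
  by (simp add: vec_eq_iff matrix_vector_mult_2 mod_lincomb)

lemma reduce_mod_add: "reduce_mod n (reduce_mod n v + w) = reduce_mod n (v + w)"
  by (simp add: vec_eq_iff mod_simps)

lemma reduce_mod_in_vertices: "n > 0 \<Longrightarrow> reduce_mod n v \<in> torus_vertices n"
  by (simp add: torus_vertices_def)

lemma reduce_mod_id [simp]: "v \<in> torus_vertices n \<Longrightarrow> reduce_mod n v = v"
  by (simp add: torus_vertices_def vec_eq_iff)

lemma torus_vertices_eq_image:
  "torus_vertices n = (\<lambda>(x, y). vector [x, y]) ` ({0..<int n} \<times> {0..<int n})"
proof (intro set_eqI iffI)
  fix v assume "v \<in> torus_vertices n"
  then have "(v $ 1, v $ 2) \<in> {0..<int n} \<times> {0..<int n}"
    by (auto simp: torus_vertices_def)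
  moreover have "v = vector [v $ 1, v $ 2]"
    by (simp add: vec_eq_iff forall_2)
  ultimately show "v \<in> (\<lambda>(x, y). vector [x, y]) ` ({0..<int n} \<times> {0..<int n})"
    by (metis (no_types, lifting) case_prod_conv image_eqI)
qed (auto simp: torus_vertices_def forall_2)

lemma finite_torus_vertices [simp]: "finite (torus_vertices n)"
  by (simp add: torus_vertices_eq_image)

lemma card_torus_vertices: "card (torus_vertices n) = n\<^sup>2"
proof -
  have "inj_on (\<lambda>(x, y). vector [x, y] :: int^2) ({0..<int n} \<times> {0..<int n})"
    by (auto simp: inj_on_def vec_eq_iff forall_2)
  then show ?thesis
    by (simp add: torus_vertices_eq_image card_image power2_eq_square)
qed

lemma bij_betw_reduce_mult:
  assumes "n > 0" "invertible M"
  shows "bij_betw (\<lambda>v. reduce_mod n (M *v v)) (torus_vertices n) (torus_vertices n)"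
proof -
  obtain L where L: "M ** L = mat 1" "L ** M = mat 1"
    using assms by (auto simp: invertible_def)
  show ?thesis
    by (rule bij_betw_byWitness[where f' = "\<lambda>v. reduce_mod n (L *v v)"])
      (auto simp: reduce_mod_mult L matrix_vector_mul_assoc reduce_mod_in_vertices[OF assms(1)])
qed

lemma bij_betw_reduce_add:
  assumes "n > 0"
  shows "bij_betw (\<lambda>v. reduce_mod n (v + w)) (torus_vertices n) (torus_vertices n)"
  by (rule bij_betw_byWitness[where f' = "\<lambda>v. reduce_mod n (v + (- w))"])
    (auto simp only: reduce_mod_add reduce_mod_in_vertices[OF assms]
      add.assoc right_minus left_minus add_0_right reduce_mod_id)

text \<open>Functions on the discrete torus are kept as functions on the integer plane that factor
  through reduction. Translations and matrices can then be composed with them without reducing after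
  every step.\<close>

definition torus_periodic :: "nat \<Rightarrow> (int^2 \<Rightarrow> 'b) \<Rightarrow> bool" where
  "torus_periodic n g \<longleftrightarrow> (\<forall>v. g (reduce_mod n v) = g v)"

lemma torus_periodicD: "torus_periodic n g \<Longrightarrow> g (reduce_mod n v) = g v"
  by (simp add: torus_periodic_def)

lemma torus_periodic_cong:
  assumes "torus_periodic n g" "reduce_mod n v = reduce_mod n w"
  shows "g v = g w"
  by (metis assms torus_periodicD)

lemma torus_periodic_mult: "torus_periodic n g \<Longrightarrow> torus_periodic n (\<lambda>v. g (M *v v))"
  unfolding torus_periodic_def by (metis reduce_mod_mult)

lemma sum_torus_mult:
  assumes "n > 0" "invertible M" "torus_periodic n g"
  shows "(\<Sum>v\<in>torus_vertices n. g (M *v v)) = (\<Sum>v\<in>torus_vertices n. g v)"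
  using sum.reindex_bij_betw[OF bij_betw_reduce_mult[OF assms(1,2)], of g] assms(3)
  by (simp add: torus_periodicD)

lemma sum_torus_add:
  assumes "n > 0" "torus_periodic n g"
  shows "(\<Sum>v\<in>torus_vertices n. g (v + w)) = (\<Sum>v\<in>torus_vertices n. g v)"
  using sum.reindex_bij_betw[OF bij_betw_reduce_add[OF assms(1)], of g] assms(2)
  by (simp add: torus_periodicD)

section \<open>Additive characters modulo \<open>n\<close>, their orthogonality and the Fourier
  transform\<close>

definition torus_char :: "nat \<Rightarrow> int^2 \<Rightarrow> int^2 \<Rightarrow> complex" where
  "torus_char n k x = cis (2 * pi * real_of_int (k $ 1 * x $ 1 + k $ 2 * x $ 2) / real n)"

lemma cis_cong_mod:
  assumes "n > 0" "p mod int n = q mod int n"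
  shows "cis (2 * pi * real_of_int p / real n) = cis (2 * pi * real_of_int q / real n)"
proof -
  from assms(2) obtain z where z: "p = q + int n * z"
    by (metis add.commute mod_eqE mult.commute)
  have "2 * pi * real_of_int p / real n
      = 2 * pi * real_of_int q / real n + 2 * pi * real_of_int z"
    using assms(1) by (simp add: z field_simps)
  then show ?thesis
    by (simp flip: cis_mult add: cis_multiple_2pi)
qed

lemma torus_char_commute: "torus_char n k x = torus_char n x k"
  by (simp add: torus_char_def mult.commute)

lemma torus_periodic_char: "n > 0 \<Longrightarrow> torus_periodic n (torus_char n k)"
  unfolding torus_periodic_def torus_char_def
  by (intro allI cis_cong_mod) (simp_all add: mod_lincomb)

lemma torus_periodic_char_left: "n > 0 \<Longrightarrow> torus_periodic n (\<lambda>k. torus_char n k x)"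
  by (subst torus_char_commute) (rule torus_periodic_char)

lemma torus_char_add: "torus_char n k (x + y) = torus_char n k x * torus_char n k y"
  by (simp add: torus_char_def cis_mult algebra_simps add_divide_distrib)

lemma torus_char_add_left: "torus_char n (k + l) x = torus_char n k x * torus_char n l x"
  by (metis torus_char_add torus_char_commute)

lemma cnj_torus_char: "cnj (torus_char n k x) = torus_char n k (- x)"
proof -
  have "k $ 1 * (- x) $ 1 + k $ 2 * (- x) $ 2 = - (k $ 1 * x $ 1 + k $ 2 * x $ 2)"
    by simp
  then show ?thesis
    unfolding torus_char_def by (simp only: cis_cnj of_int_minus mult_minus_right minus_divide_left)
qed

lemma torus_char_diff: "torus_char n (x - y) k = torus_char n k x * cnj (torus_char n k y)"
  by (metis torus_char_add torus_char_commute cnj_torus_char add_uminus_conv_diff)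

lemma norm_torus_char [simp]: "cmod (torus_char n k x) = 1"
  by (simp add: torus_char_def)

lemma torus_char_mult: "torus_char n k (M *v x) = torus_char n (transpose M *v k) x"
  by (simp add: torus_char_def matrix_vector_mult_2 transpose_def algebra_simps)

lemma torus_char_0 [simp]: "torus_char n 0 x = 1" "torus_char n k 0 = 1"
  by (simp_all add: torus_char_def)

text \<open>If \<open>k\<close> vanishes modulo \<open>n\<close>, every term is 1. Otherwise a shift
  of the summation variable by a suitable \<open>w\<close> multiplies the sum by a factor different
  from 1, so the sum is 0.\<close>

lemma sum_torus_char:
  assumes "n > 0"
  shows "(\<Sum>x\<in>torus_vertices n. torus_char n k x)
    = (if reduce_mod n k = 0 then (of_nat n)\<^sup>2 else 0)"
proof (cases "reduce_mod n k = 0")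
  case True
  have "torus_char n k x = 1" for x
    using torus_periodicD[OF torus_periodic_char_left[OF assms, of x], of k] True by simp
  then show ?thesis
    using True by (simp add: card_torus_vertices)
next
  case False
  then obtain i where i: "k $ i mod int n \<noteq> 0"
    by (auto simp: vec_eq_iff)
  \<comment> \<open>The unit vector of a coordinate in which \<open>k\<close> does not vanish modulo
    \<open>n\<close>; the character takes there the value of a nontrivial root of unity.\<close>
  define w :: "int^2" where "w = axis i 1"
  have "k $ 1 * w $ 1 + k $ 2 * w $ 2 = k $ i"
    using exhaust_2[of i] by (auto simp: w_def axis_def)
  then have ch: "torus_char n k w = cis (2 * pi * (real_of_int (k $ i) / real n))"
    by (simp add: torus_char_def)
  have "torus_char n k w \<noteq> 1"
  proof
    assume "torus_char n k w = 1"
    then have "cos (2 * pi * (real_of_int (k $ i) / real n)) = 1"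
      unfolding ch by (metis cis.sel(1) one_complex.sel(1))
    then obtain z :: int where "2 * pi * (real_of_int (k $ i) / real n) = real_of_int z * 2 * pi"
      using cos_one_2pi_int by blast
    then have "real_of_int (k $ i) = real_of_int (z * int n)"
      using assms by (simp add: field_simps)
    then have "k $ i = z * int n"
      by linarith
    with i show False by simp
  qed
  moreover have "(\<Sum>x\<in>torus_vertices n. torus_char n k x)
      = (\<Sum>x\<in>torus_vertices n. torus_char n k x) * torus_char n k w"
    using sum_torus_add[OF assms torus_periodic_char[OF assms, of k], of w]
    by (simp add: torus_char_add sum_distrib_right)
  ultimately show ?thesis
    using False by simp
qed

text \<open>The transform is unnormalised, which is the origin of the factor \<open>n\<close>
  squared in Parseval's identity and in all that follows.\<close>

definition torus_fourier :: "nat \<Rightarrow> (int^2 \<Rightarrow> complex) \<Rightarrow> int^2 \<Rightarrow> complex" where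
  "torus_fourier n f k = (\<Sum>x\<in>torus_vertices n. f x * torus_char n k x)"

lemma torus_periodic_fourier: "n > 0 \<Longrightarrow> torus_periodic n (torus_fourier n f)"
  using torus_periodic_char_left[of n] by (simp add: torus_fourier_def torus_periodic_def)

lemma torus_fourier_diff:
  "torus_fourier n (\<lambda>x. f x - g x) k = torus_fourier n f k - torus_fourier n g k"
  by (simp add: torus_fourier_def algebra_simps sum_subtractf)

lemma torus_fourier_0: "torus_fourier n f 0 = (\<Sum>x\<in>torus_vertices n. f x)"
  by (simp add: torus_fourier_def)

lemma reduce_mod_diff_eq_0:
  assumes "x \<in> torus_vertices n" "y \<in> torus_vertices n"
  shows "reduce_mod n (x - y) = 0 \<longleftrightarrow> x = y"
proof -
  have "reduce_mod n (x - y) = 0 \<longleftrightarrow> reduce_mod n x = reduce_mod n y"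
    by (simp add: vec_eq_iff mod_eq_dvd_iff dvd_eq_mod_eq_0)
  then show ?thesis using assms by simp
qed

lemma torus_parseval:
  assumes "n > 0"
  shows "(\<Sum>k\<in>torus_vertices n. (cmod (torus_fourier n f k))\<^sup>2)
    = (real n)\<^sup>2 * (\<Sum>x\<in>torus_vertices n. (cmod (f x))\<^sup>2)"
proof -
  let ?V = "torus_vertices n"
  have "complex_of_real (\<Sum>k\<in>?V. (cmod (torus_fourier n f k))\<^sup>2)
      = (\<Sum>k\<in>?V. torus_fourier n f k * cnj (torus_fourier n f k))"
    by (simp only: of_real_sum complex_norm_square)
  also have "\<dots> = (\<Sum>k\<in>?V. \<Sum>x\<in>?V. \<Sum>y\<in>?V. f x * cnj (f y) * torus_char n (x - y) k)"
    by (intro sum.cong refl)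
      (simp add: torus_fourier_def sum_product torus_char_diff mult_ac)
  also have "\<dots> = (\<Sum>x\<in>?V. \<Sum>k\<in>?V. \<Sum>y\<in>?V. f x * cnj (f y) * torus_char n (x - y) k)"
    by (rule sum.swap)
  also have "\<dots> = (\<Sum>x\<in>?V. \<Sum>y\<in>?V. f x * cnj (f y) * (\<Sum>k\<in>?V. torus_char n (x - y) k))"
    unfolding sum_distrib_left by (intro sum.cong refl sum.swap)
  also have "\<dots> = (\<Sum>x\<in>?V. \<Sum>y\<in>?V. if x = y then f x * cnj (f x) * (of_nat n)\<^sup>2 else 0)"
    by (intro sum.cong refl) (simp add: sum_torus_char[OF assms] reduce_mod_diff_eq_0)
  also have "\<dots> = complex_of_real ((real n)\<^sup>2 * (\<Sum>x\<in>?V. (cmod (f x))\<^sup>2))"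
    by (simp add: sum_distrib_left mult.commute flip: complex_norm_square)
  finally show ?thesis
    by (simp only: of_real_eq_iff)
qed

text \<open>The substitution of \<open>M *v x\<close> for \<open>x\<close>, together with the
  adjointness of \<open>M\<close> and its transpose in the pairing of \<open>k\<close> and
  \<open>x\<close>. A matrix acting on the vertices thus acts on frequencies through its
  transpose.\<close>

lemma torus_fourier_mult:
  assumes "n > 0" "invertible M" "torus_periodic n f"
  shows "torus_fourier n (\<lambda>x. f (M *v x)) (transpose M *v k) = torus_fourier n f k"
  using sum_torus_mult[OF assms(1,2), of "\<lambda>x. f x * torus_char n k x"]
    assms(3) torus_periodic_char[OF assms(1), of k]
  by (simp add: torus_fourier_def torus_char_mult torus_periodic_def)

lemma torus_fourier_shift:
  assumes "n > 0" "torus_periodic n f"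
  shows "torus_fourier n (\<lambda>x. f (x + w)) k * torus_char n k w = torus_fourier n f k"
  using sum_torus_add[OF assms(1), of "\<lambda>x. f x * torus_char n k x" w]
    assms(2) torus_periodic_char[OF assms(1), of k]
  by (simp add: torus_fourier_def torus_char_add torus_periodic_def sum_distrib_left mult_ac)

subsection \<open>Lyapunov functions of hyperbolic matrices\<close>

text \<open>A square below that of \<open>t\<close> is at most that of \<open>t - 1\<close>, and the
  gap \<open>2 * t - 1\<close> between these two squares exceeds 4.\<close>

lemma square_minus_4_not_square:
  fixes s t :: int
  assumes "t \<ge> 3"
  shows "t\<^sup>2 - 4 \<noteq> s\<^sup>2"
proof
  assume eq: "t\<^sup>2 - 4 = s\<^sup>2"
  then have "\<bar>s\<bar>\<^sup>2 < t\<^sup>2" by simp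
  then have "\<bar>s\<bar> < t"
    using assms by (simp add: power2_less_imp_less)
  then have "\<bar>s\<bar>\<^sup>2 \<le> (t - 1)\<^sup>2"
    by (intro power_mono) auto
  with eq assms show False
    by (simp add: power2_eq_square algebra_simps)
qed

text \<open>\<open>Q\<close> is the determinant of the pair consisting of a vector and its image
  under the matrix with rows \<open>(A, B)\<close> and \<open>(C, D)\<close>, so it vanishes exactly
  on the eigenlines. The bound says quantitatively that these lines and their mirror images in the
  diagonal meet only at the origin. A common zero would satisfy \<open>x = y\<close> or
  \<open>x = - y\<close>, because the difference of the two forms is a nonzero multiple of the
  difference of the squares; the sum of the forms does not vanish there.\<close>

lemma swapped_forms_lower_bound:
  fixes A B C D :: int
  assumes det: "A * D - B * C = 1" and tr: "A + D \<ge> 3" and off: "B + C \<noteq> 0"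
  defines "Q \<equiv> \<lambda>(x::real) (y::real). C * x\<^sup>2 + (D - A) * x * y - B * y\<^sup>2"
  shows "\<exists>\<kappa>>0. \<forall>x y. \<kappa> * (x\<^sup>2 + y\<^sup>2)\<^sup>2 \<le> (Q x y)\<^sup>2 + (Q y x)\<^sup>2"
proof -
  define q m s :: real where "q = C - B" and "m = D - A" and "s = B + C"
  \<comment> \<open>With determinant 1 this identity turns a coincidence of the squares of
    \<open>C - B\<close> and \<open>D - A\<close> into the forbidden equation "trace squared minus 4
    is a square". Integrality then gives a gap of at least 1.\<close>
  have "(A + D)\<^sup>2 - 4 - (B + C)\<^sup>2 = (D - A)\<^sup>2 - (C - B)\<^sup>2 + 4 * (A * D - B * C - 1)"
    by (simp add: power2_eq_square algebra_simps)
  then have "(C - B)\<^sup>2 - (D - A)\<^sup>2 \<noteq> 0"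
    using square_minus_4_not_square[OF tr, of "B + C"] det by simp
  then have "1 \<le> \<bar>(C - B)\<^sup>2 - (D - A)\<^sup>2\<bar>" by simp
  then have qm: "1 \<le> \<bar>q\<^sup>2 - m\<^sup>2\<bar>"
    unfolding q_def m_def by (metis of_int_1_le_iff of_int_abs of_int_diff of_int_power)
  have "1 \<le> \<bar>B + C\<bar>" using off by simp
  then have s1: "1 \<le> \<bar>s\<bar>" unfolding s_def by linarith
  \<comment> \<open>Large enough to dominate both coefficients,
    \<open>\<bar>q\<bar> + \<bar>m\<bar>\<close> and the square of \<open>m\<close>, in the estimate
    of \<open>N\<close> below; the summand 1 keeps it positive.\<close>
  define L where "L = \<bar>q\<bar> + \<bar>m\<bar> + m\<^sup>2 + 1"
  have L: "L > 0" by (simp add: L_def add_nonneg_pos)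
  have bound: "x\<^sup>2 + y\<^sup>2 \<le> L * (\<bar>Q x y - Q y x\<bar> + \<bar>Q x y + Q y x\<bar>)" for x y
  proof -
    \<comment> \<open>In polar coordinates \<open>P\<close> and \<open>Z\<close> are
      \<open>N\<close> times the cosine and the sine of the doubled angle.\<close>
    define N P Z where "N = x\<^sup>2 + y\<^sup>2" and "P = x\<^sup>2 - y\<^sup>2" and "Z = 2 * x * y"
    have NPZ: "P\<^sup>2 + Z\<^sup>2 = N\<^sup>2"
      by (simp add: N_def P_def Z_def power2_eq_square algebra_simps)
    have N0: "N \<ge> 0" by (simp add: N_def)
    have PN: "\<bar>P\<bar> \<le> N" and ZN: "\<bar>Z\<bar> \<le> N"
      using NPZ N0 zero_le_power2[of P] zero_le_power2[of Z] abs_le_square_iff[of P N]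
        abs_le_square_iff[of Z N] by linarith+
    have d: "Q x y - Q y x = s * P"
      by (simp add: Q_def s_def P_def power2_eq_square algebra_simps)
    have e: "Q x y + Q y x = q * N + m * Z"
      by (simp add: Q_def q_def m_def N_def Z_def power2_eq_square algebra_simps)
    \<comment> \<open>The difference of squares of \<open>q * N\<close> and \<open>m * Z\<close>
      factors with \<open>q * N + m * Z\<close> as one factor; replacing the square of
      \<open>Z\<close> leaves only a term in \<open>P\<close>. Hence \<open>N\<close> is controlled
      by the sum and the difference of the forms.\<close>
    have "N * N = 1 * N\<^sup>2" by (simp add: power2_eq_square)
    also have "\<dots> \<le> \<bar>q\<^sup>2 - m\<^sup>2\<bar> * N\<^sup>2"
      by (intro mult_right_mono qm) simp
    also have "\<dots> = \<bar>(q\<^sup>2 - m\<^sup>2) * N\<^sup>2\<bar>"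
      by (simp add: abs_mult)
    also have "(q\<^sup>2 - m\<^sup>2) * N\<^sup>2 = q\<^sup>2 * N\<^sup>2 - m\<^sup>2 * (P\<^sup>2 + Z\<^sup>2)"
      by (simp add: NPZ algebra_simps)
    also have "\<dots> = (q * N + m * Z) * (q * N - m * Z) - m\<^sup>2 * P\<^sup>2"
      by (simp add: power2_eq_square algebra_simps)
    also have "\<bar>\<dots>\<bar> \<le> \<bar>q * N + m * Z\<bar> * \<bar>q * N - m * Z\<bar> + m\<^sup>2 * P\<^sup>2"
      by (rule order_trans[OF abs_triangle_ineq4]) (simp add: abs_mult)
    also have "\<dots> \<le> \<bar>q * N + m * Z\<bar> * ((\<bar>q\<bar> + \<bar>m\<bar>) * N) + m\<^sup>2 * (\<bar>P\<bar> * N)"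
    proof (intro add_mono mult_left_mono)
      have "\<bar>q * N - m * Z\<bar> \<le> \<bar>q\<bar> * N + \<bar>m\<bar> * \<bar>Z\<bar>"
        using N0 by (intro order_trans[OF abs_triangle_ineq4]) (simp add: abs_mult)
      also have "\<dots> \<le> \<bar>q\<bar> * N + \<bar>m\<bar> * N"
        by (intro add_mono mult_left_mono ZN) auto
      finally show "\<bar>q * N - m * Z\<bar> \<le> (\<bar>q\<bar> + \<bar>m\<bar>) * N"
        by (simp add: algebra_simps)
      have "P\<^sup>2 = \<bar>P\<bar> * \<bar>P\<bar>" by (simp add: power2_eq_square)
      also have "\<dots> \<le> \<bar>P\<bar> * N" by (intro mult_left_mono PN) simp
      finally show "P\<^sup>2 \<le> \<bar>P\<bar> * N" .
    qed auto
    also have "\<dots> = ((\<bar>q\<bar> + \<bar>m\<bar>) * \<bar>q * N + m * Z\<bar> + m\<^sup>2 * \<bar>P\<bar>) * N"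
      by (simp add: algebra_simps)
    finally have "N * N \<le> ((\<bar>q\<bar> + \<bar>m\<bar>) * \<bar>q * N + m * Z\<bar> + m\<^sup>2 * \<bar>P\<bar>) * N" .
    moreover have "0 \<le> (\<bar>q\<bar> + \<bar>m\<bar>) * \<bar>q * N + m * Z\<bar> + m\<^sup>2 * \<bar>P\<bar>" by simp
    ultimately have "N \<le> (\<bar>q\<bar> + \<bar>m\<bar>) * \<bar>q * N + m * Z\<bar> + m\<^sup>2 * \<bar>P\<bar>"
      using N0 by (cases "N = 0") (simp, metis less_eq_real_def mult_right_le_imp_le)
    also have "\<dots> \<le> L * \<bar>q * N + m * Z\<bar> + L * \<bar>s * P\<bar>"
    proof (intro add_mono mult_mono)
      show "\<bar>P\<bar> \<le> \<bar>s * P\<bar>"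
        using mult_right_mono[OF s1, of "\<bar>P\<bar>"] by (simp add: abs_mult)
    qed (use L in \<open>simp_all add: L_def\<close>)
    finally show ?thesis
      unfolding N_def[symmetric] d e by (simp add: distrib_left add.commute)
  qed
  \<comment> \<open>The 4 is a product of two factors 2: one from squaring a sum of two terms, one
    because the squares of the sum and the difference of the forms add up to twice the sum of their
    squares.\<close>
  have "1 / (4 * L\<^sup>2) * (x\<^sup>2 + y\<^sup>2)\<^sup>2 \<le> (Q x y)\<^sup>2 + (Q y x)\<^sup>2" for x y
  proof -
    have "(x\<^sup>2 + y\<^sup>2)\<^sup>2 \<le> (L * (\<bar>Q x y - Q y x\<bar> + \<bar>Q x y + Q y x\<bar>))\<^sup>2"
      by (intro power_mono bound) simp
    also have "\<dots> \<le> L\<^sup>2 * (2 * (\<bar>Q x y - Q y x\<bar>\<^sup>2 + \<bar>Q x y + Q y x\<bar>\<^sup>2))"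
      unfolding power_mult_distrib
      using sum_squares_bound[of "\<bar>Q x y - Q y x\<bar>" "\<bar>Q x y + Q y x\<bar>"]
      by (intro mult_left_mono) (simp_all add: power2_sum)
    also have "\<dots> = 4 * L\<^sup>2 * ((Q x y)\<^sup>2 + (Q y x)\<^sup>2)"
      by (simp add: power2_eq_square algebra_simps)
    finally show ?thesis
      using L by (simp add: field_simps)
  qed
  then show ?thesis
    using L by (intro exI[of _ "1 / (4 * L\<^sup>2)"]) auto
qed

text \<open>The increment equals \<open>(l - m) * U * W\<close> divided by
  \<open>(l * U + m * W) * (U + W)\<close>, and the first factor of this denominator is at most
  \<open>l * (U + W)\<close>.\<close>

lemma weighted_share_increase:
  fixes U W l m :: real
  assumes "U \<ge> 0" "W \<ge> 0" "U + W > 0" "0 < m" "m < l"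
  shows "l * U / (l * U + m * W) - U / (U + W) \<ge> (l - m) / l * (U * W / (U + W)\<^sup>2)"
proof -
  have pos: "l * U + m * W > 0"
    using assms by (smt (verit, best) mult_nonneg_nonneg mult_pos_pos)
  have le: "l * U + m * W \<le> l * (U + W)"
    using assms by (simp add: algebra_simps mult_left_mono)
  have "(l - m) / l * (U * W / (U + W)\<^sup>2) = (l - m) * (U * W) / (l * (U + W) * (U + W))"
    by (simp add: power2_eq_square)
  also have "\<dots> \<le> (l - m) * (U * W) / ((l * U + m * W) * (U + W))"
    using assms pos le by (intro divide_left_mono mult_right_mono mult_pos_pos) auto
  also have "\<dots> = l * U / (l * U + m * W) - U / (U + W)"
    using assms pos by (simp add: divide_simps) (simp add: algebra_simps)
  finally show ?thesis .
qed

text \<open>The Lyapunov function is the share of the expanding coordinate \<open>u\<close> in \<open>u\<^sup>2 + w\<^sup>2\<close>, where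
  \<open>u\<close> and \<open>w\<close> are the eigencoordinates; \<open>u * w\<close> is a multiple of the invariant quadratic form.\<close>

lemma hyperbolic_lyapunov:
  fixes A B C D :: int
  assumes det: "A * D - B * C = 1" and tr: "A + D \<ge> 3" and off: "B + C \<noteq> 0"
  shows "\<exists>(F :: int \<Rightarrow> int \<Rightarrow> real) c. c > 0 \<and> (\<forall>x y. F x y \<in> {0..1}) \<and>
    (\<forall>x y. (x, y) \<noteq> (0, 0) \<longrightarrow>
      c \<le> F (A * x + B * y) (C * x + D * y) - F x y + (F (A * y + B * x) (C * y + D * x) - F y x))"
proof -
  define \<tau> :: real where "\<tau> = A + D"
  define r where "r = sqrt (\<tau>\<^sup>2 - 4)"
  \<comment> \<open>The eigenvalues: roots of the characteristic polynomial with trace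
    \<open>\<tau>\<close> and determinant 1. They are reciprocal, and \<open>\<alpha>\<close> is the
    expanding one.\<close>
  define \<alpha> \<beta> where "\<alpha> = (\<tau> + r) / 2" and "\<beta> = (\<tau> - r) / 2"
  have \<tau>3: "\<tau> \<ge> 3" using tr by (simp add: \<tau>_def flip: of_int_add)
  then have "\<tau>\<^sup>2 - 4 \<ge> 0"
    using power_mono[OF \<tau>3, of 2] by simp
  then have r: "r \<ge> 0" "r * r = \<tau> * \<tau> - 4" by (simp_all add: r_def power2_eq_square)
  have sum: "\<alpha> + \<beta> = \<tau>" by (simp add: \<alpha>_def \<beta>_def field_simps)
  have "4 * (\<alpha> * \<beta>) = \<tau> * \<tau> - r * r"
    unfolding \<alpha>_def \<beta>_def by (simp add: field_simps)
  then have prod: "\<alpha> * \<beta> = 1"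
    using r(2) by simp
  have "\<alpha> > 1"
    using \<tau>3 r(1) by (simp add: \<alpha>_def)
  then have \<beta>: "0 < \<beta>" "\<beta> < 1"
    using prod by (smt (verit) zero_less_mult_iff, smt (verit) mult_less_cancel_left1 mult.commute zero_less_mult_iff)
  have \<alpha>\<beta>: "0 < \<beta>\<^sup>2" "\<beta>\<^sup>2 < \<alpha>\<^sup>2"
    using \<beta> \<open>\<alpha> > 1\<close> by (auto intro!: power_strict_mono)
  \<comment> \<open>With \<open>C = 0\<close> both diagonal entries would be 1 or both -1, against
    the bound on the trace. The coordinates \<open>u\<close> and \<open>w\<close> below would
    degenerate without this.\<close>
  have C0: "C \<noteq> 0"
  proof
    assume "C = 0"
    then have "A * D = 1" using det by simp
    then show False using tr by (auto simp: zmult_eq_1_iff)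
  qed
  define Q where "Q = (\<lambda>(x::real) (y::real). C * x\<^sup>2 + (D - A) * x * y - B * y\<^sup>2)"
  obtain \<kappa> where \<kappa>: "\<kappa> > 0" "\<And>x y. \<kappa> * (x\<^sup>2 + y\<^sup>2)\<^sup>2 \<le> (Q x y)\<^sup>2 + (Q y x)\<^sup>2"
    using swapped_forms_lower_bound[OF det tr off] unfolding Q_def by auto
  \<comment> \<open>Pairings with the left eigenvectors \<open>(C, \<alpha> - A)\<close> and
    \<open>(C, \<beta> - A)\<close>; a step of the matrix multiplies \<open>u\<close> by
    \<open>\<alpha>\<close> and \<open>w\<close> by \<open>\<beta>\<close>.\<close>
  define u w where "u = (\<lambda>(x::real) (y::real). C * x + (\<alpha> - A) * y)"
    and "w = (\<lambda>(x::real) (y::real). C * x + (\<beta> - A) * y)"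
  have detr: "real_of_int A * D - B * C = 1"
    using arg_cong[OF det, of real_of_int] by simp
  have eig: "z * (z - A) = D * z - 1" if "z = \<alpha> \<or> z = \<beta>" for z :: real
  proof -
    have "z * z = \<tau> * z - 1"
      using that
    proof
      assume "z = \<alpha>" then show ?thesis using prod by (simp add: sum[symmetric] algebra_simps)
    next
      assume "z = \<beta>" then show ?thesis using prod by (simp add: sum[symmetric] algebra_simps)
    qed
    then show ?thesis by (simp add: \<tau>_def algebra_simps)
  qed
  have BC: "real_of_int C * B = A * D - 1" using detr by (simp add: algebra_simps)
  have eigen: "C * (A * x + B * y) + (z - A) * (C * x + D * y) = z * (C * x + (z - A) * y)"
    if "z = \<alpha> \<or> z = \<beta>" for x y z :: real
  proof -
    have "C * (A * x + B * y) + (z - A) * (C * x + D * y)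
        = z * C * x + (real_of_int C * B - A * D + D * z) * y"
      by (simp add: algebra_simps)
    also have "\<dots> = z * C * x + (z * (z - A)) * y"
      by (simp only: BC eig[OF that]) simp
    finally show ?thesis by (simp add: algebra_simps)
  qed
  have u_step: "u (A * x + B * y) (C * x + D * y) = \<alpha> * u x y"
    and w_step: "w (A * x + B * y) (C * x + D * y) = \<beta> * w x y" for x y :: real
    using eigen unfolding u_def w_def by auto
  have uw: "u x y * w x y = C * Q x y" for x y :: real
  proof -
    have "u x y * w x y = real_of_int C * C * x * x + C * (\<alpha> + \<beta> - 2 * A) * x * y
        + (\<alpha> * \<beta> - (\<alpha> + \<beta>) * A + A * A) * y * y"
      by (simp add: u_def w_def algebra_simps)
    also have "\<dots> = real_of_int C * C * x * x + C * (D - A) * x * y + (1 - A * D) * y * y"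
      by (simp add: sum prod \<tau>_def algebra_simps)
    also have "\<dots> = real_of_int C * C * x * x + C * (D - A) * x * y - (real_of_int C * B) * y * y"
      by (simp only: BC) (simp add: algebra_simps)
    also have "\<dots> = C * Q x y"
      by (simp add: Q_def power2_eq_square algebra_simps)
    finally show ?thesis .
  qed
  have pos: "(u x y)\<^sup>2 + (w x y)\<^sup>2 > 0" if "(x, y) \<noteq> (0, 0)" for x y :: real
  proof (rule ccontr)
    assume "\<not> ?thesis"
    then have uw0: "u x y = 0" "w x y = 0"
      by (auto simp: sum_power2_gt_zero_iff)
    have "(\<alpha> - \<beta>) * y = u x y - w x y" by (simp add: u_def w_def algebra_simps)
    then have "(\<alpha> - \<beta>) * y = 0" using uw0 by simp
    then have "y = 0" using \<beta> \<open>\<alpha> > 1\<close> by simp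
    then show False using uw0(1) C0 that by (simp add: u_def)
  qed
  \<comment> \<open>The Cauchy-Schwarz constant that compares the sum of squares of the
    eigencoordinates with that of \<open>x\<close> and \<open>y\<close>.\<close>
  define K where "K = 2 * (real_of_int C)\<^sup>2 + (\<alpha> - A)\<^sup>2 + (\<beta> - A)\<^sup>2"
  have "K > 0" using C0 by (auto simp: K_def intro!: add_pos_nonneg)
  have CS: "(p * x + r * y)\<^sup>2 \<le> (p\<^sup>2 + r\<^sup>2) * (x\<^sup>2 + y\<^sup>2)" for p r x y :: real
  proof -
    have "(p\<^sup>2 + r\<^sup>2) * (x\<^sup>2 + y\<^sup>2) - (p * x + r * y)\<^sup>2 = (p * y - r * x)\<^sup>2"
      by (simp add: power2_eq_square algebra_simps)
    then show ?thesis by (smt (verit) zero_le_power2)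
  qed
  have upper: "(u x y)\<^sup>2 + (w x y)\<^sup>2 \<le> K * (x\<^sup>2 + y\<^sup>2)" for x y :: real
  proof -
    have "(u x y)\<^sup>2 + (w x y)\<^sup>2 \<le> ((real_of_int C)\<^sup>2 + (\<alpha> - A)\<^sup>2) * (x\<^sup>2 + y\<^sup>2)
        + ((real_of_int C)\<^sup>2 + (\<beta> - A)\<^sup>2) * (x\<^sup>2 + y\<^sup>2)"
      unfolding u_def w_def by (intro add_mono CS)
    then show ?thesis by (simp add: K_def algebra_simps)
  qed
  \<comment> \<open>At the origin the quotient is 0 / 0, hence 0, so the values lie in the unit
    interval everywhere.\<close>
  define F where "F = (\<lambda>(x::real) (y::real). (u x y)\<^sup>2 / ((u x y)\<^sup>2 + (w x y)\<^sup>2))"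
  define \<rho> where "\<rho> = (\<alpha>\<^sup>2 - \<beta>\<^sup>2) / \<alpha>\<^sup>2"
  have \<rho>: "\<rho> > 0" unfolding \<rho>_def using \<alpha>\<beta> \<open>\<alpha> > 1\<close> by (intro divide_pos_pos) auto
  define e where "e = \<rho> * (real_of_int C)\<^sup>2 / K\<^sup>2"
  have e: "e > 0" using \<rho> C0 \<open>K > 0\<close> by (simp add: e_def)
  \<comment> \<open>One step gains at least a multiple of the squared normalised form, a bound that
    degenerates only on the eigenlines.\<close>
  have gain: "e * ((Q x y)\<^sup>2 / (x\<^sup>2 + y\<^sup>2)\<^sup>2) \<le> F (A * x + B * y) (C * x + D * y) - F x y"
    if "(x, y) \<noteq> (0, 0)" for x y :: real
  proof -
    have N: "x\<^sup>2 + y\<^sup>2 > 0"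
      using that by (auto simp: sum_power2_gt_zero_iff)
    have "e * ((Q x y)\<^sup>2 / (x\<^sup>2 + y\<^sup>2)\<^sup>2) = \<rho> * ((C * Q x y)\<^sup>2 / (K * (x\<^sup>2 + y\<^sup>2))\<^sup>2)"
      by (simp add: e_def power_mult_distrib)
    also have "\<dots> \<le> \<rho> * ((C * Q x y)\<^sup>2 / ((u x y)\<^sup>2 + (w x y)\<^sup>2)\<^sup>2)"
      using \<rho> pos[OF that] upper[of x y] N \<open>K > 0\<close>
      by (intro mult_left_mono divide_left_mono power_mono mult_pos_pos zero_less_power) auto
    also have "(C * Q x y)\<^sup>2 = (u x y)\<^sup>2 * (w x y)\<^sup>2"
      by (simp flip: uw add: power_mult_distrib)
    also have "\<rho> * ((u x y)\<^sup>2 * (w x y)\<^sup>2 / ((u x y)\<^sup>2 + (w x y)\<^sup>2)\<^sup>2)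
        \<le> \<alpha>\<^sup>2 * (u x y)\<^sup>2 / (\<alpha>\<^sup>2 * (u x y)\<^sup>2 + \<beta>\<^sup>2 * (w x y)\<^sup>2) - (u x y)\<^sup>2 / ((u x y)\<^sup>2 + (w x y)\<^sup>2)"
      unfolding \<rho>_def using pos[OF that] \<alpha>\<beta> by (intro weighted_share_increase) auto
    also have "\<dots> = F (A * x + B * y) (C * x + D * y) - F x y"
      by (simp add: F_def u_step w_step power_mult_distrib)
    finally show ?thesis .
  qed
  \<comment> \<open>The same gain at \<open>(y, x)\<close> supplies the form with exchanged
    arguments; the two forms cannot be small together.\<close>
  have total: "e * \<kappa> \<le> F (A * x + B * y) (C * x + D * y) - F x y
      + (F (A * y + B * x) (C * y + D * x) - F y x)" if "(x, y) \<noteq> (0, 0)" for x y :: real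
  proof -
    have N: "x\<^sup>2 + y\<^sup>2 > 0"
      using that by (auto simp: sum_power2_gt_zero_iff)
    have "e * \<kappa> = e * (\<kappa> * (x\<^sup>2 + y\<^sup>2)\<^sup>2 / (x\<^sup>2 + y\<^sup>2)\<^sup>2)"
      by (subst nonzero_mult_div_cancel_right) (use that in auto)
    also have "\<dots> \<le> e * (((Q x y)\<^sup>2 + (Q y x)\<^sup>2) / (x\<^sup>2 + y\<^sup>2)\<^sup>2)"
      using e by (intro mult_left_mono divide_right_mono \<kappa>) auto
    also have "\<dots> = e * ((Q x y)\<^sup>2 / (x\<^sup>2 + y\<^sup>2)\<^sup>2) + e * ((Q y x)\<^sup>2 / (y\<^sup>2 + x\<^sup>2)\<^sup>2)"
      by (simp add: add_divide_distrib distrib_left add.commute)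
    also have "\<dots> \<le> F (A * x + B * y) (C * x + D * y) - F x y
      + (F (A * y + B * x) (C * y + D * x) - F y x)"
      using that by (intro add_mono gain) auto
    finally show ?thesis .
  qed
  have "U / (U + W) \<in> {0..1}" if "U \<ge> 0" "W \<ge> 0" for U W :: real
    using that by (cases "U + W = 0") (auto simp: divide_simps)
  then have F01: "F x y \<in> {0..1}" for x y :: real
    unfolding F_def by simp
  show ?thesis
  proof (intro exI conjI allI impI)
    show "e * \<kappa> > 0" using e \<kappa> by simp
    show "(\<lambda>(x::int) (y::int). F x y) x y \<in> {0..1}" for x y using F01 by simp
    fix x y :: int assume "(x, y) \<noteq> (0, 0)"
    then show "e * \<kappa> \<le> (\<lambda>(x::int) (y::int). F x y) (A * x + B * y) (C * x + D * y) - (\<lambda>(x::int) (y::int). F x y) x y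
      + ((\<lambda>(x::int) (y::int). F x y) (A * y + B * x) (C * y + D * x) - (\<lambda>(x::int) (y::int). F x y) y x)"
      using total[of x y] by simp
  qed
qed

subsection \<open>The spectral gap on the Fourier side\<close>

definition centered :: "nat \<Rightarrow> int^2 \<Rightarrow> int^2" where
  "centered n v = (\<chi> i. (v $ i + int (n div 2)) mod int n - int (n div 2))"

lemma reduce_mod_centered [simp]: "reduce_mod n (centered n v) = reduce_mod n v"
  by (simp add: vec_eq_iff centered_def mod_simps)

lemma torus_periodic_centered: "torus_periodic n (centered n)"
  by (simp add: torus_periodic_def vec_eq_iff centered_def mod_simps)

lemma centered_bound:
  assumes "n > 0"
  shows "\<bar>2 * centered n v $ i\<bar> \<le> int n"
proof -
  have "0 \<le> (v $ i + int (n div 2)) mod int n" "(v $ i + int (n div 2)) mod int n < int n"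
    using assms by simp_all
  moreover have "2 * int (n div 2) \<le> int n" "int n \<le> 2 * int (n div 2) + 1"
    by linarith+
  ultimately show ?thesis
    unfolding centered_def by simp
qed

lemma centered_id:
  assumes "\<And>i. \<bar>2 * v $ i\<bar> < int n"
  shows "centered n v = v"
proof -
  have "(v $ i + int (n div 2)) mod int n = v $ i + int (n div 2)" for i
    using assms[of i] by (intro mod_pos_pos_trivial) linarith+
  then show ?thesis
    by (simp add: vec_eq_iff centered_def)
qed

text \<open>The squared distance of \<open>cis t\<close> from 1 is \<open>2 - 2 * cos t\<close>. The
  absolute value keeps the angle between 0 and \<open>pi\<close>, where the cosine is
  decreasing.\<close>

lemma norm_torus_char_basis:
  assumes "n > 0" "w = vector [1, 0] \<and> i = 1 \<or> w = vector [0, 1] \<and> i = 2"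
  shows "(cmod (torus_char n k w - 1))\<^sup>2
    = 2 - 2 * cos (2 * pi * real_of_int \<bar>centered n k $ i\<bar> / real n)"
proof -
  let ?t = "2 * pi * real_of_int (centered n k $ i) / real n"
  have "torus_char n k w = torus_char n (centered n k) w"
    using torus_periodic_cong[OF torus_periodic_char_left[OF assms(1)]] reduce_mod_centered by metis
  also have "\<dots> = cis ?t"
    using assms(2) by (auto simp: torus_char_def)
  also have "(cmod (cis ?t - 1))\<^sup>2 = (cos ?t - 1)\<^sup>2 + (sin ?t)\<^sup>2"
    by (simp add: cmod_power2)
  also have "\<dots> = 2 - 2 * cos ?t"
    using sin_cos_squared_add[of ?t] by (simp add: power2_eq_square algebra_simps)
  also have "cos ?t = cos \<bar>?t\<bar>" by (rule cos_abs_real[symmetric])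
  also have "\<bar>?t\<bar> = 2 * pi * real_of_int \<bar>centered n k $ i\<bar> / real n"
    by (simp add: abs_mult)
  finally show ?thesis by simp
qed

text \<open>Near \<open>0\<close> the matrices act on the centered representatives without wrapping around; away from
  \<open>0\<close> one of the two basic characters is bounded away from \<open>1\<close>.\<close>

lemma lyapunov_mod:
  fixes F F' :: "int^2 \<Rightarrow> real" and N N' :: "int^2^2"
  assumes F: "\<And>v. F v \<in> {0..1}" "\<And>v. F' v \<in> {0..1}" and c: "c > 0"
    and gain: "\<And>v. v \<noteq> 0 \<Longrightarrow> c \<le> F (N *v v) - F v + (F' (N' *v v) - F' v)"
  shows "\<exists>K\<ge>0. \<forall>n>0. \<forall>k. reduce_mod n k \<noteq> 0 \<longrightarrow>
    c \<le> F (centered n (N *v k)) - F (centered n k)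
      + (F' (centered n (N' *v k)) - F' (centered n k))
      + K * ((cmod (torus_char n k (vector [1, 0]) - 1))\<^sup>2
           + (cmod (torus_char n k (vector [0, 1]) - 1))\<^sup>2)"
proof -
  \<comment> \<open>A bound for the absolute row sums of both matrices: they cannot move a frequency
    across the boundary while its coordinates stay below \<open>n / (2 * m)\<close>.\<close>
  define m where "m = 1 + (\<Sum>i\<in>UNIV. \<Sum>j\<in>UNIV. \<bar>N $ i $ j\<bar> + \<bar>N' $ i $ j\<bar>)"
  have m1: "m \<ge> 1" by (simp add: m_def sum_nonneg)
  have row: "\<bar>N $ i $ 1\<bar> + \<bar>N $ i $ 2\<bar> \<le> m" "\<bar>N' $ i $ 1\<bar> + \<bar>N' $ i $ 2\<bar> \<le> m" for i
    using exhaust_2[of i] by (auto simp: m_def sum_2)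
  \<comment> \<open>The squared distance of a basic character from 1 when the frequency coordinate
    has size \<open>n / (2 * m)\<close>, that is, at the angle \<open>pi / m\<close>.\<close>
  define \<eta> where "\<eta> = 2 - 2 * cos (pi / real_of_int m)"
  have "pi / real_of_int m \<le> pi" "0 < pi / real_of_int m"
    using m1 by (simp_all add: field_simps)
  then have \<eta>: "\<eta> > 0"
    using cos_monotone_0_pi[of 0 "pi / real_of_int m"] by (simp add: \<eta>_def)
  have small: "centered n (L *v k) = L *v centered n k"
    if "n > 0" and L: "\<And>i. \<bar>L $ i $ 1\<bar> + \<bar>L $ i $ 2\<bar> \<le> m"
      and v: "\<And>i. m * \<bar>2 * centered n k $ i\<bar> < int n" for n k and L :: "int^2^2"
  proof -
    have "centered n (L *v k) = centered n (L *v centered n k)"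
      by (intro torus_periodic_cong[OF torus_periodic_centered])
        (metis reduce_mod_centered reduce_mod_mult)
    also have "\<dots> = L *v centered n k"
    proof (intro centered_id)
      fix i
      define V where "V = max \<bar>2 * centered n k $ 1\<bar> \<bar>2 * centered n k $ 2\<bar>"
      have V: "\<bar>2 * centered n k $ 1\<bar> \<le> V" "\<bar>2 * centered n k $ 2\<bar> \<le> V" "V \<ge> 0"
        by (auto simp: V_def)
      have "\<bar>2 * (L *v centered n k) $ i\<bar>
          = \<bar>L $ i $ 1 * (2 * centered n k $ 1) + L $ i $ 2 * (2 * centered n k $ 2)\<bar>"
        by (simp add: matrix_vector_mult_2 algebra_simps)
      also have "\<dots> \<le> \<bar>L $ i $ 1\<bar> * \<bar>2 * centered n k $ 1\<bar> + \<bar>L $ i $ 2\<bar> * \<bar>2 * centered n k $ 2\<bar>"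
        by (rule order_trans[OF abs_triangle_ineq]) (simp add: abs_mult)
      also have "\<dots> \<le> \<bar>L $ i $ 1\<bar> * V + \<bar>L $ i $ 2\<bar> * V"
        using V by (intro add_mono mult_left_mono) auto
      also have "\<dots> \<le> m * V"
        using mult_right_mono[OF L[of i] V(3)] by (simp add: algebra_simps)
      also have "\<dots> < int n"
        using v[of 1] v[of 2] by (auto simp: V_def max_def)
      finally show "\<bar>2 * (L *v centered n k) $ i\<bar> < int n" .
    qed
    finally show ?thesis .
  qed
  \<comment> \<open>Each of the two increments is at least -1, so away from the origin the penalty
    has to reach \<open>c + 2\<close>.\<close>
  define K where "K = (c + 2) / \<eta>"
  have K: "K \<ge> 0" using c \<eta> by (simp add: K_def)
  show ?thesis
  proof (intro exI conjI allI impI)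
    show "K \<ge> 0" by fact
    fix n k assume n: "n > (0::nat)" and k: "reduce_mod n k \<noteq> 0"
    let ?T = "(cmod (torus_char n k (vector [1, 0]) - 1))\<^sup>2
           + (cmod (torus_char n k (vector [0, 1]) - 1))\<^sup>2"
    show "c \<le> F (centered n (N *v k)) - F (centered n k)
      + (F' (centered n (N' *v k)) - F' (centered n k)) + K * ?T"
    proof (cases "\<forall>i. m * \<bar>2 * centered n k $ i\<bar> < int n")
      case True
      have "centered n k \<noteq> 0"
        using k reduce_mod_centered[of n k] by (metis mod_0 reduce_mod_nth vec_eq_iff zero_index)
      from gain[OF this] True n row K show ?thesis
        by (simp add: small add_increasing2)
    next
      case False
      then obtain i where i: "int n \<le> m * \<bar>2 * centered n k $ i\<bar>" by (auto simp: not_less)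
      let ?t = "2 * pi * real_of_int \<bar>centered n k $ i\<bar> / real n"
      have "real_of_int (int n) \<le> real_of_int (m * \<bar>2 * centered n k $ i\<bar>)"
        using i by (simp only: of_int_le_iff)
      then have lo: "pi / real_of_int m \<le> ?t"
        using n m1 by (simp add: field_simps abs_mult)
      have "real_of_int \<bar>2 * centered n k $ i\<bar> \<le> real_of_int (int n)"
        using centered_bound[OF n] by (simp only: of_int_le_iff)
      then have hi: "?t \<le> pi"
        using n by (simp add: field_simps abs_mult)
      have "cos ?t \<le> cos (pi / real_of_int m)"
        using lo hi m1 by (intro cos_monotone_0_pi_le) auto
      then have "\<eta> \<le> 2 - 2 * cos ?t" by (simp add: \<eta>_def)
      also have "\<dots> \<le> ?T"
        using norm_torus_char_basis[OF n, of "vector [1, 0]" 1 k]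
          norm_torus_char_basis[OF n, of "vector [0, 1]" 2 k] exhaust_2[of i]
        by (auto simp: cos_le_one)
      finally have "K * \<eta> \<le> K * ?T" using K by (rule mult_left_mono)
      then have "c + 2 \<le> K * ?T" using \<eta> by (simp add: K_def)
      moreover have "0 \<le> F (centered n (N *v k))" "F (centered n k) \<le> 1"
        "0 \<le> F' (centered n (N' *v k))" "F' (centered n k) \<le> 1"
        using F by auto
      ultimately show ?thesis by linarith
    qed
  qed
qed

section \<open>Almost invariant Fourier mass, and its incompatibility with a Lyapunov
  function\<close>

lemma abs_diff_norm_squares:
  fixes a b :: complex
  assumes "\<theta> > 0"
  shows "\<bar>(cmod a)\<^sup>2 - (cmod b)\<^sup>2\<bar> \<le> (cmod (a - b))\<^sup>2 / (4 * \<theta>) + 2 * \<theta> * ((cmod a)\<^sup>2 + (cmod b)\<^sup>2)"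
proof -
  let ?d = "cmod (a - b)" and ?s = "cmod a + cmod b"
  have "\<bar>(cmod a)\<^sup>2 - (cmod b)\<^sup>2\<bar> = \<bar>cmod a - cmod b\<bar> * ?s"
    by (simp add: power2_eq_square square_diff_square_factored abs_mult)
  also have "\<dots> \<le> ?d * ?s"
    by (intro mult_right_mono norm_triangle_ineq3) auto
  also have "\<dots> \<le> ?d\<^sup>2 / (4 * \<theta>) + \<theta> * ?s\<^sup>2"
  proof -
    have "0 \<le> (?d - 2 * \<theta> * ?s)\<^sup>2 / (4 * \<theta>)" using assms by simp
    also have "\<dots> = ?d\<^sup>2 / (4 * \<theta>) + \<theta> * ?s\<^sup>2 - ?d * ?s"
      using assms by (simp add: power2_eq_square field_simps)
    finally show ?thesis by simp
  qed
  also have "\<dots> \<le> ?d\<^sup>2 / (4 * \<theta>) + \<theta> * (2 * ((cmod a)\<^sup>2 + (cmod b)\<^sup>2))"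
    using assms sum_squares_bound[of "cmod a" "cmod b"]
    by (intro add_left_mono mult_left_mono) (auto simp: power2_sum)
  finally show ?thesis by (simp add: mult.left_commute mult.assoc)
qed

text \<open>Summation by parts: the substitution of \<open>N *v k\<close> for \<open>k\<close> moves
  the increment from \<open>H\<close> to the squared modulus of \<open>\<phi>\<close>. As
  \<open>H\<close> lies between 0 and 1, only the variation of this modulus counts, and it is
  bounded termwise with the free parameter \<open>\<theta>\<close>.\<close>

lemma sum_weight_increment_le:
  assumes n: "n > 0" and N: "invertible N" and H: "torus_periodic n H" "\<And>v. H v \<in> {0..(1::real)}"
    and \<phi>: "torus_periodic n \<phi>" and \<theta>: "\<theta> > 0"
  shows "(\<Sum>k\<in>torus_vertices n. (H (N *v k) - H k) * (cmod (\<phi> k))\<^sup>2)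
    \<le> (\<Sum>k\<in>torus_vertices n. (cmod (\<phi> (N *v k) - \<phi> k))\<^sup>2) / (4 * \<theta>)
      + 4 * \<theta> * (\<Sum>k\<in>torus_vertices n. (cmod (\<phi> k))\<^sup>2)"
proof -
  let ?V = "torus_vertices n"
  have inv: "(\<Sum>k\<in>?V. (cmod (\<phi> (N *v k)))\<^sup>2) = (\<Sum>k\<in>?V. (cmod (\<phi> k))\<^sup>2)"
    using \<phi> by (intro sum_torus_mult[OF n N]) (simp add: torus_periodic_def)
  have "(\<Sum>k\<in>?V. H k * (cmod (\<phi> k))\<^sup>2) = (\<Sum>k\<in>?V. H (N *v k) * (cmod (\<phi> (N *v k)))\<^sup>2)"
    using \<phi> H(1) by (intro sum_torus_mult[OF n N, symmetric]) (simp add: torus_periodic_def)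
  then have "(\<Sum>k\<in>?V. (H (N *v k) - H k) * (cmod (\<phi> k))\<^sup>2)
      = (\<Sum>k\<in>?V. H (N *v k) * ((cmod (\<phi> k))\<^sup>2 - (cmod (\<phi> (N *v k)))\<^sup>2))"
    by (simp add: algebra_simps sum_subtractf)
  also have "\<dots> \<le> (\<Sum>k\<in>?V. (cmod (\<phi> (N *v k) - \<phi> k))\<^sup>2 / (4 * \<theta>)
      + 2 * \<theta> * ((cmod (\<phi> k))\<^sup>2 + (cmod (\<phi> (N *v k)))\<^sup>2))"
  proof (rule sum_mono)
    fix k
    let ?D = "(cmod (\<phi> k))\<^sup>2 - (cmod (\<phi> (N *v k)))\<^sup>2"
    have "H (N *v k) * ?D \<le> H (N *v k) * \<bar>?D\<bar>"
      using H(2) by (intro mult_left_mono) auto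
    also have "\<dots> \<le> 1 * \<bar>?D\<bar>"
      using H(2) by (intro mult_right_mono) auto
    also have "\<dots> \<le> (cmod (\<phi> (N *v k) - \<phi> k))\<^sup>2 / (4 * \<theta>)
      + 2 * \<theta> * ((cmod (\<phi> k))\<^sup>2 + (cmod (\<phi> (N *v k)))\<^sup>2)"
      using abs_diff_norm_squares[OF \<theta>, of "\<phi> k" "\<phi> (N *v k)"] by (simp add: norm_minus_commute)
    finally show "H (N *v k) * ?D \<le> \<dots>" .
  qed
  also have "\<dots> = (\<Sum>k\<in>?V. (cmod (\<phi> (N *v k) - \<phi> k))\<^sup>2) / (4 * \<theta>)
      + 4 * \<theta> * (\<Sum>k\<in>?V. (cmod (\<phi> k))\<^sup>2)"
    unfolding sum.distrib sum_divide_distrib[symmetric] sum_distrib_left[symmetric] inv by simp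
  finally show ?thesis .
qed

definition displacement :: "nat \<Rightarrow> (int^2 \<Rightarrow> complex) \<Rightarrow> (int^2 \<Rightarrow> int^2) \<Rightarrow> real" where
  "displacement n f \<phi> = (\<Sum>v\<in>torus_vertices n. (cmod (f (\<phi> v) - f v))\<^sup>2)"

lemma invertible_transpose_int: "invertible (M :: int^2^2) \<Longrightarrow> invertible (transpose M)"
  unfolding invertible_def by (metis matrix_transpose_mul transpose_mat)

text \<open>The difference of coefficients is the transform of \<open>f x - f (M *v x)\<close> at
  \<open>transpose M *v k\<close>; reindexing the frequencies and Parseval's identity
  finish.\<close>

lemma fourier_displacement_mult:
  assumes "n > 0" "invertible M" "torus_periodic n f"
  shows "(\<Sum>k\<in>torus_vertices n.
      (cmod (torus_fourier n f (transpose M *v k) - torus_fourier n f k))\<^sup>2)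
    = (real n)\<^sup>2 * displacement n f ((*v) M)"
proof -
  let ?g = "\<lambda>x. f x - f (M *v x)"
  have "torus_fourier n f (transpose M *v k) - torus_fourier n f k
      = torus_fourier n ?g (transpose M *v k)" for k
    by (simp only: torus_fourier_diff torus_fourier_mult[OF assms])
  then have "(\<Sum>k\<in>torus_vertices n.
      (cmod (torus_fourier n f (transpose M *v k) - torus_fourier n f k))\<^sup>2)
    = (\<Sum>k\<in>torus_vertices n. (cmod (torus_fourier n ?g k))\<^sup>2)"
    using sum_torus_mult[OF assms(1) invertible_transpose_int[OF assms(2)],
        of "\<lambda>k. (cmod (torus_fourier n ?g k))\<^sup>2"] torus_periodic_fourier[OF assms(1), of ?g]
    by (simp add: torus_periodic_def)
  then show ?thesis
    by (simp add: torus_parseval[OF assms(1)] displacement_def norm_minus_commute)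
qed

text \<open>A translation multiplies each Fourier coefficient by a number of modulus 1, so the
  transform of the difference has modulus \<open>cmod (torus_char n k w - 1)\<close> times that of
  \<open>f\<close>. Parseval's identity applies.\<close>

lemma fourier_displacement_add:
  assumes "n > 0" "torus_periodic n f"
  shows "(\<Sum>k\<in>torus_vertices n.
      (cmod (torus_char n k w - 1))\<^sup>2 * (cmod (torus_fourier n f k))\<^sup>2)
    = (real n)\<^sup>2 * displacement n f (\<lambda>v. v + w)"
proof -
  let ?g = "\<lambda>x. f (x + w) - f x"
  have "cmod (torus_char n k w - 1) * cmod (torus_fourier n f k) = cmod (torus_fourier n ?g k)" for k
  proof -
    have "torus_fourier n ?g k * torus_char n k w = - ((torus_char n k w - 1) * torus_fourier n f k)"
      by (simp only: torus_fourier_diff left_diff_distrib torus_fourier_shift[OF assms])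
        (simp add: mult.commute)
    then show ?thesis
      by (metis norm_mult norm_minus_cancel norm_torus_char mult.right_neutral)
  qed
  then have "(\<Sum>k\<in>torus_vertices n.
      (cmod (torus_char n k w - 1))\<^sup>2 * (cmod (torus_fourier n f k))\<^sup>2)
    = (\<Sum>k\<in>torus_vertices n. (cmod (torus_fourier n ?g k))\<^sup>2)"
    by (simp flip: power_mult_distrib)
  then show ?thesis
    by (simp add: torus_parseval[OF assms(1)] displacement_def)
qed

text \<open>The pointwise Lyapunov inequality is multiplied by the squared Fourier coefficient and
  summed over all frequencies; the frequency 0 carries no mass since \<open>f\<close> has mean zero.
  The increments are paid for by the displacements under \<open>M\<close> and \<open>M'\<close>, the
  penalty by those under the two translations.\<close>

lemma torus_spectral_gap:
  fixes F F' :: "int^2 \<Rightarrow> real" and M M' :: "int^2^2"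
  assumes F: "\<And>v. F v \<in> {0..1}" "\<And>v. F' v \<in> {0..1}" and c: "c > 0"
    and gain: "\<And>v. v \<noteq> 0 \<Longrightarrow>
      c \<le> F (transpose M *v v) - F v + (F' (transpose M' *v v) - F' v)"
    and M: "invertible M" "invertible M'"
  shows "\<exists>K>0. \<forall>n>0. \<forall>f. torus_periodic n f \<longrightarrow> (\<Sum>v\<in>torus_vertices n. f v) = 0 \<longrightarrow>
    (\<Sum>v\<in>torus_vertices n. (cmod (f v))\<^sup>2)
    \<le> K * (displacement n f (\<lambda>v. v + vector [1, 0]) + displacement n f (\<lambda>v. v + vector [0, 1])
       + displacement n f ((*v) M) + displacement n f ((*v) M'))"
proof -
  let ?N = "transpose M" and ?N' = "transpose M'"
  obtain K where K: "K \<ge> 0" "\<And>n k. n > 0 \<Longrightarrow> reduce_mod n k \<noteq> 0 \<Longrightarrow>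
    c \<le> F (centered n (?N *v k)) - F (centered n k)
      + (F' (centered n (?N' *v k)) - F' (centered n k))
      + K * ((cmod (torus_char n k (vector [1, 0]) - 1))\<^sup>2
           + (cmod (torus_char n k (vector [0, 1]) - 1))\<^sup>2)"
    using lyapunov_mod[OF F c gain] by metis
  define K' where "K' = 2 / c * (K + 4 / c)"
  have "K' > 0" using K(1) c by (simp add: K'_def add_nonneg_pos)
  moreover have "(\<Sum>v\<in>torus_vertices n. (cmod (f v))\<^sup>2)
    \<le> K' * (displacement n f (\<lambda>v. v + vector [1, 0]) + displacement n f (\<lambda>v. v + vector [0, 1])
       + displacement n f ((*v) M) + displacement n f ((*v) M'))"
    if n: "n > 0" and f: "torus_periodic n f" "(\<Sum>v\<in>torus_vertices n. f v) = 0" for n f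
  proof -
    let ?V = "torus_vertices n"
    define p where "p = (\<lambda>k. (cmod (torus_fourier n f k))\<^sup>2)"
    define P where "P = (\<Sum>k\<in>?V. p k)"
    define e1 e2 e3 e4 where "e1 = displacement n f (\<lambda>v. v + vector [1, 0])"
      and "e2 = displacement n f (\<lambda>v. v + vector [0, 1])"
      and "e3 = displacement n f ((*v) M)" and "e4 = displacement n f ((*v) M')"
    have e: "e1 \<ge> 0" "e2 \<ge> 0" "e3 \<ge> 0" "e4 \<ge> 0"
      by (simp_all add: e1_def e2_def e3_def e4_def displacement_def sum_nonneg)
    have per: "torus_periodic n (\<lambda>k. H (centered n k))" for H :: "int^2 \<Rightarrow> real"
      using torus_periodic_centered[of n] by (simp add: torus_periodic_def)
    \<comment> \<open>Chosen so that the two error terms \<open>4 * \<theta> * P\<close> add up to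
      \<open>c / 2 * P\<close>, which the left side absorbs.\<close>
    define \<theta> where "\<theta> = c / 16"
    have \<theta>: "\<theta> > 0" using c by (simp add: \<theta>_def)
    have "c * P \<le> (\<Sum>k\<in>?V. (F (centered n (?N *v k)) - F (centered n k)) * p k
      + (F' (centered n (?N' *v k)) - F' (centered n k)) * p k
      + K * ((cmod (torus_char n k (vector [1, 0]) - 1))\<^sup>2 * p k
           + (cmod (torus_char n k (vector [0, 1]) - 1))\<^sup>2 * p k))"
      unfolding P_def sum_distrib_left
    proof (rule sum_mono)
      fix k assume "k \<in> ?V"
      show "c * p k \<le> (F (centered n (?N *v k)) - F (centered n k)) * p k
      + (F' (centered n (?N' *v k)) - F' (centered n k)) * p k
      + K * ((cmod (torus_char n k (vector [1, 0]) - 1))\<^sup>2 * p k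
           + (cmod (torus_char n k (vector [0, 1]) - 1))\<^sup>2 * p k)"
      proof (cases "k = 0")
        case True
        then have "p k = 0" by (simp add: p_def torus_fourier_0 f)
        then show ?thesis by simp
      next
        case False
        then have "reduce_mod n k \<noteq> 0" using \<open>k \<in> ?V\<close> by simp
        from mult_right_mono[OF K(2)[OF n this], of "p k"] show ?thesis
          by (simp add: p_def algebra_simps)
      qed
    qed
    also have "\<dots> = (\<Sum>k\<in>?V. (F (centered n (?N *v k)) - F (centered n k)) * p k)
      + (\<Sum>k\<in>?V. (F' (centered n (?N' *v k)) - F' (centered n k)) * p k)
      + K * ((real n)\<^sup>2 * e1 + (real n)\<^sup>2 * e2)"
      unfolding e1_def e2_def fourier_displacement_add[OF n f(1), symmetric] p_def
      by (simp add: sum.distrib flip: sum_distrib_left)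
    also have "\<dots> \<le> ((real n)\<^sup>2 * e3 / (4 * \<theta>) + 4 * \<theta> * P) + ((real n)\<^sup>2 * e4 / (4 * \<theta>) + 4 * \<theta> * P)
      + K * ((real n)\<^sup>2 * e1 + (real n)\<^sup>2 * e2)"
      unfolding e3_def e4_def fourier_displacement_mult[OF n M(1) f(1), symmetric]
        fourier_displacement_mult[OF n M(2) f(1), symmetric] p_def P_def
      using F by (intro add_mono order_refl sum_weight_increment_le n \<theta> per torus_periodic_fourier
        invertible_transpose_int M)
    also have "\<dots> = (real n)\<^sup>2 * (4 / c * (e3 + e4) + K * (e1 + e2)) + c / 2 * P"
      using c by (simp add: \<theta>_def field_simps)
    finally have "c / 2 * P \<le> (real n)\<^sup>2 * (4 / c * (e3 + e4) + K * (e1 + e2))"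
      by linarith
    also have "\<dots> \<le> (real n)\<^sup>2 * ((K + 4 / c) * (e1 + e2 + e3 + e4))"
    proof (intro mult_left_mono)
      have "4 / c * (e3 + e4) + K * (e1 + e2) \<le> (K + 4 / c) * (e3 + e4) + (K + 4 / c) * (e1 + e2)"
        using e c K(1) by (intro add_mono mult_right_mono) auto
      then show "4 / c * (e3 + e4) + K * (e1 + e2) \<le> (K + 4 / c) * (e1 + e2 + e3 + e4)"
        by (simp only: distrib_left add_ac)
    qed simp
    finally have "c / 2 * ((real n)\<^sup>2 * (\<Sum>v\<in>?V. (cmod (f v))\<^sup>2))
        \<le> (real n)\<^sup>2 * ((K + 4 / c) * (e1 + e2 + e3 + e4))"
      by (simp add: P_def p_def torus_parseval[OF n])
    then have "(real n)\<^sup>2 * (c / 2 * (\<Sum>v\<in>?V. (cmod (f v))\<^sup>2))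
        \<le> (real n)\<^sup>2 * ((K + 4 / c) * (e1 + e2 + e3 + e4))"
      by (simp add: mult.left_commute)
    then have "c / 2 * (\<Sum>v\<in>?V. (cmod (f v))\<^sup>2) \<le> (K + 4 / c) * (e1 + e2 + e3 + e4)"
      by (rule mult_left_le_imp_le) (use n in simp)
    then have le: "2 / c * (c / 2 * (\<Sum>v\<in>?V. (cmod (f v))\<^sup>2)) \<le> 2 / c * ((K + 4 / c) * (e1 + e2 + e3 + e4))"
      using c by (intro mult_left_mono) auto
    have "(\<Sum>v\<in>?V. (cmod (f v))\<^sup>2) = 2 / c * (c / 2 * (\<Sum>v\<in>?V. (cmod (f v))\<^sup>2))"
      using c by simp
    also note le
    also have "2 / c * ((K + 4 / c) * (e1 + e2 + e3 + e4)) = K' * (e1 + e2 + e3 + e4)"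
      by (simp only: K'_def mult.assoc)
    finally show ?thesis
      unfolding e1_def e2_def e3_def e4_def .
  qed
  ultimately show ?thesis by metis
qed

subsection \<open>Energies on torus graphs\<close>

lemma matrix_inv_mult:
  assumes "invertible (M :: int^2^2)"
  shows "M ** matrix_inv M = mat 1" "matrix_inv M ** M = mat 1"
proof -
  have "\<exists>L. M ** L = mat 1 \<and> L ** M = mat 1"
    using assms by (simp add: invertible_def)
  from someI_ex[OF this] show "M ** matrix_inv M = mat 1" "matrix_inv M ** M = mat 1"
    by (simp_all add: matrix_inv_def)
qed

lemma invertible_matrix_inv_int: "invertible (M :: int^2^2) \<Longrightarrow> invertible (matrix_inv M)"
  using matrix_inv_mult unfolding invertible_def by blast

text \<open>The neighbours are regarded as values of self-maps of the plane, because each such map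
  permutes the vertices modulo \<open>n\<close> and can be treated by a change of variables.\<close>

definition torus_moves :: "int^2^2 \<Rightarrow> int^2^2 \<Rightarrow> (int^2 \<Rightarrow> int^2) set" where
  "torus_moves S T = {\<lambda>v. v + vector [1, 0], \<lambda>v. v - vector [1, 0], \<lambda>v. v + vector [0, 1],
     \<lambda>v. v - vector [0, 1], (*v) S, (*v) (matrix_inv S), (*v) T, (*v) (matrix_inv T)}"

lemma finite_torus_moves [simp]: "finite (torus_moves S T)"
  by (simp add: torus_moves_def)

lemma card_torus_moves: "card (torus_moves S T) \<le> 8"
  unfolding torus_moves_def by (rule card_insert_le_m1, simp)+ simp

definition move_edge :: "nat \<Rightarrow> (int^2 \<Rightarrow> int^2) \<Rightarrow> int^2 \<Rightarrow> (int^2) uprod" where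
  "move_edge n \<phi> v = Upair v (reduce_mod n (\<phi> v))"

lemma fst_torus_graph [simp]: "fst (torus_graph S T n) = torus_vertices n"
  by (simp add: torus_graph_def)

lemma torus_edges_eq:
  "snd (torus_graph S T n) = (\<lambda>(\<phi>, v). move_edge n \<phi> v) ` (torus_moves S T \<times> torus_vertices n)"
proof -
  have "torus_neighbours S T v = (\<lambda>\<phi>. \<phi> v) ` torus_moves S T" for v
    by (simp add: torus_neighbours_def torus_moves_def)
  then show ?thesis
    unfolding torus_graph_def move_edge_def by auto
qed

lemma finite_torus_edges [simp]: "finite (snd (torus_graph S T n))"
  by (simp add: torus_edges_eq)

lemma finite_ugraph_torus_graph: "n > 0 \<Longrightarrow> finite_ugraph (torus_graph S T n)"
  by (auto simp: finite_ugraph_def torus_edges_eq move_edge_def reduce_mod_in_vertices)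

lemma bij_betw_torus_move:
  assumes "n > 0" "invertible S" "invertible T" "\<phi> \<in> torus_moves S T"
  shows "bij_betw (\<lambda>v. reduce_mod n (\<phi> v)) (torus_vertices n) (torus_vertices n)"
proof -
  consider w where "\<phi> = (\<lambda>v. v + w)" | M where "\<phi> = (*v) M" "invertible M"
    using assms unfolding torus_moves_def diff_conv_add_uminus
    by (elim insertE emptyE) (blast intro: invertible_matrix_inv_int)+
  then show ?thesis
    using bij_betw_reduce_add bij_betw_reduce_mult assms(1) by cases auto
qed

text \<open>Each of the at most eight moves permutes the vertices, so it yields at most two edges at
  \<open>v\<close>: one leaving \<open>v\<close> and one arriving there.\<close>

lemma ugraph_degree_torus_graph_le:
  assumes "n > 0" "invertible S" "invertible T"
  shows "ugraph_degree (torus_graph S T n) v \<le> 16"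
proof -
  let ?V = "torus_vertices n" and ?E = "\<lambda>(\<phi>, v). move_edge n \<phi> v"
  define A where "A = (\<lambda>\<phi>. {u \<in> ?V. u = v \<or> reduce_mod n (\<phi> u) = v})"
  have A: "card (A \<phi>) \<le> 2" if "\<phi> \<in> torus_moves S T" for \<phi>
  proof -
    have inj: "inj_on (\<lambda>u. reduce_mod n (\<phi> u)) ?V"
      using bij_betw_torus_move[OF assms that] by (rule bij_betw_imp_inj_on)
    have "card {u \<in> ?V. reduce_mod n (\<phi> u) = v} \<le> 1"
      by (rule card_le_Suc0_iff_eq[THEN iffD2, simplified One_nat_def[symmetric]])
        (auto dest: inj_onD[OF inj])
    moreover have "card {u \<in> ?V. u = v} \<le> 1"
      by (rule card_le_Suc0_iff_eq[THEN iffD2, simplified One_nat_def[symmetric]]) auto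
    moreover have eq: "A \<phi> = {u \<in> ?V. u = v} \<union> {u \<in> ?V. reduce_mod n (\<phi> u) = v}"
      by (auto simp: A_def)
    ultimately show ?thesis
      using card_Un_le[of "{u \<in> ?V. u = v}" "{u \<in> ?V. reduce_mod n (\<phi> u) = v}"]
      unfolding eq by linarith
  qed
  have fin: "finite (Sigma (torus_moves S T) A)" by (auto simp: A_def)
  have "{e \<in> snd (torus_graph S T n). v \<in> set_uprod e} \<subseteq> ?E ` Sigma (torus_moves S T) A"
    by (auto simp: torus_edges_eq move_edge_def A_def)
  then have "ugraph_degree (torus_graph S T n) v \<le> card (?E ` Sigma (torus_moves S T) A)"
    unfolding ugraph_degree_def using fin by (intro card_mono finite_imageI)
  also have "\<dots> \<le> card (Sigma (torus_moves S T) A)"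
    by (rule card_image_le[OF fin])
  also have "\<dots> = (\<Sum>\<phi>\<in>torus_moves S T. card (A \<phi>))"
    by (intro card_SigmaI) (auto simp: A_def)
  also have "\<dots> \<le> card (torus_moves S T) * 2"
    using sum_bounded_above[of "torus_moves S T" "\<lambda>\<phi>. card (A \<phi>)" 2] A by simp
  also have "\<dots> \<le> 16" using card_torus_moves[of S T] by simp
  finally show ?thesis .
qed

section \<open>Comparison of \<open>lambda2\<close> and the edge energy with displacements\<close>

lemma edge_energy_nonneg [simp]: "0 \<le> edge_energy f e"
  by (cases e) simp

lemma lambda2_le:
  assumes "u \<in> fst G" "f u \<noteq> 0" "(\<Sum>u\<in>fst G. f u) = 0"
  shows "lambda2 G \<le> (\<Sum>e\<in>snd G. edge_energy f e) / (\<Sum>u\<in>fst G. (cmod (f u))\<^sup>2)"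
  unfolding lambda2_def
proof (rule cInf_lower)
  show "bdd_below {(\<Sum>e\<in>snd G. edge_energy f e) / (\<Sum>u\<in>fst G. (cmod (f u))\<^sup>2) | f.
     (\<exists>u\<in>fst G. f u \<noteq> 0) \<and> (\<Sum>u\<in>fst G. f u) = 0}"
    by (rule bdd_belowI[of _ 0]) (auto intro!: divide_nonneg_nonneg sum_nonneg)
qed (use assms in blast)

text \<open>Two distinct vertices make the set of Rayleigh quotients nonempty, as the infimum
  requires: the difference of their indicator functions is admissible.\<close>

lemma lambda2_ge:
  assumes "finite (fst G)" "u \<in> fst G" "v \<in> fst G" "u \<noteq> v"
    and gap: "\<And>f. (\<Sum>u\<in>fst G. f u) = 0 \<Longrightarrow>
      c * (\<Sum>u\<in>fst G. (cmod (f u))\<^sup>2) \<le> (\<Sum>e\<in>snd G. edge_energy f e)"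
  shows "c \<le> lambda2 G"
  unfolding lambda2_def
proof (rule cInf_greatest)
  let ?f = "\<lambda>x. (if x = u then 1 else 0) - (if x = v then 1 else 0) :: complex"
  have "(\<Sum>x\<in>fst G. ?f x) = 0" "?f u \<noteq> 0"
    using assms(1-4) by (simp_all add: sum_subtractf)
  then have "(\<Sum>e\<in>snd G. edge_energy ?f e) / (\<Sum>u\<in>fst G. (cmod (?f u))\<^sup>2)
    \<in> {(\<Sum>e\<in>snd G. edge_energy f e) / (\<Sum>u\<in>fst G. (cmod (f u))\<^sup>2) | f.
     (\<exists>u\<in>fst G. f u \<noteq> 0) \<and> (\<Sum>u\<in>fst G. f u) = 0}"
    using assms(2) by (intro CollectI exI[of _ ?f] conjI bexI[of _ u] refl)
  then show "{(\<Sum>e\<in>snd G. edge_energy f e) / (\<Sum>u\<in>fst G. (cmod (f u))\<^sup>2) | f.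
     (\<exists>u\<in>fst G. f u \<noteq> 0) \<and> (\<Sum>u\<in>fst G. f u) = 0} \<noteq> {}"
    by (metis empty_iff)
next
  fix x assume "x \<in> {(\<Sum>e\<in>snd G. edge_energy f e) / (\<Sum>u\<in>fst G. (cmod (f u))\<^sup>2) | f.
     (\<exists>u\<in>fst G. f u \<noteq> 0) \<and> (\<Sum>u\<in>fst G. f u) = 0}"
  then obtain f w where x: "x = (\<Sum>e\<in>snd G. edge_energy f e) / (\<Sum>u\<in>fst G. (cmod (f u))\<^sup>2)"
    and f: "w \<in> fst G" "f w \<noteq> 0" "(\<Sum>u\<in>fst G. f u) = 0"
    by blast
  have "(\<Sum>u\<in>fst G. (cmod (f u))\<^sup>2) > 0"
    using assms(1) f by (intro sum_pos2[of _ w]) auto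
  then show "c \<le> x"
    using gap[OF f(3)] by (simp add: x field_simps)
qed

text \<open>A fixed move produces a given undirected edge from at most two vertices, namely its
  endpoints; hence the factor 2.\<close>

lemma displacement_le_energy:
  assumes "\<phi> \<in> torus_moves S T"
  shows "displacement n (\<lambda>v. f (reduce_mod n v)) \<phi>
    \<le> 2 * (\<Sum>e\<in>snd (torus_graph S T n). edge_energy f e)"
proof -
  let ?V = "torus_vertices n"
  have "displacement n (\<lambda>v. f (reduce_mod n v)) \<phi> = (\<Sum>v\<in>?V. edge_energy f (move_edge n \<phi> v))"
    by (simp add: displacement_def move_edge_def norm_minus_commute)
  also have "\<dots> = (\<Sum>e\<in>move_edge n \<phi> ` ?V. \<Sum>v\<in>{v \<in> ?V. move_edge n \<phi> v = e}. edge_energy f (move_edge n \<phi> v))"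
    by (rule sum.image_gen) simp
  also have "\<dots> \<le> (\<Sum>e\<in>move_edge n \<phi> ` ?V. 2 * edge_energy f e)"
  proof (rule sum_mono)
    fix e assume "e \<in> move_edge n \<phi> ` ?V"
    then obtain u where e: "e = move_edge n \<phi> u" by blast
    have "card {v \<in> ?V. move_edge n \<phi> v = e} \<le> card {u, reduce_mod n (\<phi> u)}"
      by (rule card_mono) (auto simp: e move_edge_def)
    also have "\<dots> \<le> 2" by (simp add: card_insert_if)
    finally have "real (card {v \<in> ?V. move_edge n \<phi> v = e}) * edge_energy f e \<le> 2 * edge_energy f e"
      by (intro mult_right_mono) auto
    then show "(\<Sum>v\<in>{v \<in> ?V. move_edge n \<phi> v = e}. edge_energy f (move_edge n \<phi> v)) \<le> 2 * edge_energy f e"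
      by simp
  qed
  also have "\<dots> \<le> (\<Sum>e\<in>snd (torus_graph S T n). 2 * edge_energy f e)"
    using assms by (intro sum_mono2) (auto simp: torus_edges_eq)
  finally show ?thesis by (simp add: sum_distrib_left)
qed

text \<open>The edges are the image of all pairs of a move and a vertex; pairs with the same edge
  only increase the right side.\<close>

lemma energy_le_displacements:
  assumes "torus_periodic n f"
  shows "(\<Sum>e\<in>snd (torus_graph S T n). edge_energy f e) \<le> (\<Sum>\<phi>\<in>torus_moves S T. displacement n f \<phi>)"
proof -
  let ?I = "torus_moves S T \<times> torus_vertices n"
  have "(\<Sum>e\<in>snd (torus_graph S T n). edge_energy f e)
      \<le> sum (edge_energy f \<circ> (\<lambda>(\<phi>, v). move_edge n \<phi> v)) ?I"
    unfolding torus_edges_eq by (rule sum_image_le) auto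
  also have "\<dots> = (\<Sum>(\<phi>, v)\<in>?I. (cmod (f (\<phi> v) - f v))\<^sup>2)"
    using torus_periodicD[OF assms]
    by (intro sum.cong) (auto simp: move_edge_def norm_minus_commute)
  finally show ?thesis
    by (simp add: displacement_def sum.cartesian_product)
qed

text \<open>The path from \<open>v\<close> through \<open>Y *v v\<close> to
  \<open>X *v (Y *v v)\<close>; since \<open>Y\<close> permutes the torus, the sum over its
  first-step endpoints is again a sum over all vertices.\<close>

lemma displacement_compose:
  assumes "n > 0" "invertible Y" "torus_periodic n f"
  shows "displacement n f ((*v) (X ** Y)) \<le> 2 * displacement n f ((*v) X) + 2 * displacement n f ((*v) Y)"
proof -
  let ?V = "torus_vertices n"
  have "displacement n f ((*v) (X ** Y))
      \<le> (\<Sum>v\<in>?V. 2 * (cmod (f (X *v (Y *v v)) - f (Y *v v)))\<^sup>2 + 2 * (cmod (f (Y *v v) - f v))\<^sup>2)"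
    unfolding displacement_def
  proof (rule sum_mono)
    fix v
    let ?a = "f (X *v (Y *v v)) - f (Y *v v)" and ?b = "f (Y *v v) - f v"
    have "(cmod (?a + ?b))\<^sup>2 \<le> (cmod ?a + cmod ?b)\<^sup>2"
      by (intro power_mono norm_triangle_ineq) simp
    also have "\<dots> \<le> 2 * (cmod ?a)\<^sup>2 + 2 * (cmod ?b)\<^sup>2"
      using sum_squares_bound[of "cmod ?a" "cmod ?b"] by (simp add: power2_sum)
    finally show "(cmod (f (X ** Y *v v) - f v))\<^sup>2 \<le> 2 * (cmod ?a)\<^sup>2 + 2 * (cmod ?b)\<^sup>2"
      by (simp add: matrix_vector_mul_assoc)
  qed
  also have "\<dots> = 2 * (\<Sum>v\<in>?V. (cmod (f (X *v (Y *v v)) - f (Y *v v)))\<^sup>2) + 2 * displacement n f ((*v) Y)"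
    by (simp add: sum.distrib displacement_def sum_distrib_left)
  also have "(\<Sum>v\<in>?V. (cmod (f (X *v (Y *v v)) - f (Y *v v)))\<^sup>2) = displacement n f ((*v) X)"
    unfolding displacement_def
    using torus_periodic_mult[OF assms(3), of X] assms(3)
    by (intro sum_torus_mult[OF assms(1,2), of "\<lambda>v. (cmod (f (X *v v) - f v))\<^sup>2"])
      (simp add: torus_periodic_def)
  finally show ?thesis .
qed

section \<open>Conjugation by the coordinate swap and the expanding case\<close>

abbreviation coord_swap :: "int^2^2" where
  "coord_swap \<equiv> vector [vector [0, 1], vector [1, 0]]"

lemma coord_swap_involution: "coord_swap ** coord_swap = mat 1"
  by (simp add: vec_eq_iff forall_2 matrix_matrix_mult_def sum_2 mat_def)

lemma invertible_coord_swap: "invertible coord_swap"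
  using coord_swap_involution by (auto simp: invertible_def)

lemma coord_swap_conjugate:
  "(coord_swap ** M ** coord_swap) $ 1 $ 1 = M $ 2 $ 2"
  "(coord_swap ** M ** coord_swap) $ 1 $ 2 = M $ 2 $ 1"
  "(coord_swap ** M ** coord_swap) $ 2 $ 1 = M $ 1 $ 2"
  "(coord_swap ** M ** coord_swap) $ 2 $ 2 = M $ 1 $ 1"
  by (simp_all add: matrix_matrix_mult_def sum_2)

text \<open>Frequencies are moved by transposes, so the Lyapunov function is taken for the transpose
  of \<open>M\<close>. Conjugating by the swap exchanges the two arguments, hence the second
  function is the first with its arguments exchanged.\<close>

lemma hyperbolic_torus_gap:
  fixes M :: "int^2^2"
  assumes "det M = 1" "M $ 1 $ 1 + M $ 2 $ 2 \<ge> 3" "M $ 1 $ 2 + M $ 2 $ 1 \<noteq> 0" and inv: "invertible M"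
  defines "M' \<equiv> coord_swap ** M ** coord_swap"
  shows "\<exists>K>0. \<forall>n>0. \<forall>f. torus_periodic n f \<longrightarrow> (\<Sum>v\<in>torus_vertices n. f v) = 0 \<longrightarrow>
    (\<Sum>v\<in>torus_vertices n. (cmod (f v))\<^sup>2)
    \<le> K * (displacement n f (\<lambda>v. v + vector [1, 0]) + displacement n f (\<lambda>v. v + vector [0, 1])
       + displacement n f ((*v) M) + displacement n f ((*v) M'))"
proof -
  let ?A = "M $ 1 $ 1" and ?B = "M $ 2 $ 1" and ?C = "M $ 1 $ 2" and ?D = "M $ 2 $ 2"
  have "?A * ?D - ?B * ?C = 1" "?A + ?D \<ge> 3" "?B + ?C \<noteq> 0"
    using assms(1-3) by (simp_all add: det_2 mult.commute add.commute)
  then obtain F :: "int \<Rightarrow> int \<Rightarrow> real" and c where c: "c > 0" and F: "\<And>x y. F x y \<in> {0..1}"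
    and gain: "\<And>x y. (x, y) \<noteq> (0, 0) \<Longrightarrow> c \<le> F (?A * x + ?B * y) (?C * x + ?D * y) - F x y
      + (F (?A * y + ?B * x) (?C * y + ?D * x) - F y x)"
    using hyperbolic_lyapunov[of ?A ?D ?B ?C] by metis
  have "invertible M'"
    unfolding M'_def by (intro invertible_mult invertible_coord_swap inv)
  show ?thesis
  proof (rule torus_spectral_gap[where F = "\<lambda>v. F (v $ 1) (v $ 2)" and F' = "\<lambda>v. F (v $ 2) (v $ 1)" and c = c])
    fix v :: "int^2"
    assume "v \<noteq> 0"
    then have "(v $ 1, v $ 2) \<noteq> (0, 0)" by (auto simp: vec_eq_iff forall_2)
    from gain[OF this]
    show "c \<le> F ((transpose M *v v) $ 1) ((transpose M *v v) $ 2) - F (v $ 1) (v $ 2)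
      + (F ((transpose M' *v v) $ 2) ((transpose M' *v v) $ 1) - F (v $ 2) (v $ 1))"
      unfolding matrix_vector_mult_2 transpose_def M'_def
      by (simp add: coord_swap_conjugate add.commute)
  qed (use F c inv \<open>invertible M'\<close> in auto)
qed

lemma det_invertible_int:
  assumes "invertible (M :: int^2^2)"
  shows "det M = 1 \<or> det M = - 1"
proof -
  have "det M * det (matrix_inv M) = 1"
    by (metis assms det_I det_mul matrix_inv_mult(1))
  then show ?thesis by (auto simp: zmult_eq_1_iff)
qed

lemma expander_torus_graph:
  fixes S :: "int^2^2"
  defines "T \<equiv> coord_swap ** S ** coord_swap"
  assumes S: "invertible S" and nz: "(S $ 1 $ 1 + S $ 2 $ 2) * (S $ 1 $ 2 + S $ 2 $ 1) \<noteq> 0"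
  shows "expander_family {2..} (torus_graph S T)"
proof -
  let ?t = "S $ 1 $ 1 + S $ 2 $ 2" and ?s = "S $ 1 $ 2 + S $ 2 $ 1"
  have T: "invertible T"
    unfolding T_def by (intro invertible_mult invertible_coord_swap S)
  have T_nth: "T $ 1 $ 1 = S $ 2 $ 2" "T $ 1 $ 2 = S $ 2 $ 1" "T $ 2 $ 1 = S $ 1 $ 2" "T $ 2 $ 2 = S $ 1 $ 1"
    unfolding T_def by (rule coord_swap_conjugate)+
  have detT: "det T = det S" by (simp add: det_2 T_nth)
  have conj: "coord_swap ** (S ** T) ** coord_swap = T ** S" "coord_swap ** (S ** S) ** coord_swap = T ** T"
    unfolding T_def
    by (metis (no_types, lifting) coord_swap_involution matrix_mul_assoc matrix_mul_rid)+
  obtain Y where Y: "Y = S \<or> Y = T" "det (S ** Y) = 1"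
    "(S ** Y) $ 1 $ 1 + (S ** Y) $ 2 $ 2 \<ge> 3" "(S ** Y) $ 1 $ 2 + (S ** Y) $ 2 $ 1 \<noteq> 0"
  proof -
    have sq: "?s\<^sup>2 \<ge> 1" "?t\<^sup>2 \<ge> 1"
      using nz by (simp_all add: int_one_le_iff_zero_less)
    show ?thesis
    proof (cases "det S = 1")
      case True
      have "(S ** T) $ 1 $ 1 + (S ** T) $ 2 $ 2 = ?s\<^sup>2 + 2 * det S"
        by (simp add: matrix_matrix_mult_def sum_2 T_nth det_2 power2_eq_square algebra_simps)
      moreover have "(S ** T) $ 1 $ 2 + (S ** T) $ 2 $ 1 = ?t * ?s"
        by (simp add: matrix_matrix_mult_def sum_2 T_nth algebra_simps)
      ultimately show ?thesis
        using that[of T] sq nz True detT by (simp add: det_mul)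
    next
      case False
      then have det: "det S = - 1" using det_invertible_int[OF S] by blast
      have "(S ** S) $ 1 $ 1 + (S ** S) $ 2 $ 2 = ?t\<^sup>2 - 2 * det S"
        by (simp add: matrix_matrix_mult_def sum_2 det_2 power2_eq_square algebra_simps)
      moreover have "(S ** S) $ 1 $ 2 + (S ** S) $ 2 $ 1 = ?t * ?s"
        by (simp add: matrix_matrix_mult_def sum_2 algebra_simps)
      ultimately show ?thesis
        using that[of S] sq nz det by (simp add: det_mul)
    qed
  qed
  \<comment> \<open>Conjugation by the swap exchanges \<open>S\<close> and \<open>T\<close>, so the
    mirror image of \<open>S ** Y\<close> is \<open>T\<close> times the other choice.\<close>
  define Y' where "Y' = (if Y = S then T else S)"
  have Y': "Y' = S \<or> Y' = T" "coord_swap ** (S ** Y) ** coord_swap = T ** Y'"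
    using Y(1) conj by (auto simp: Y'_def)
  have invY: "invertible Y" "invertible Y'" using S T Y(1) Y'(1) by auto
  obtain K where K: "K > 0" "\<And>n f. n > 0 \<Longrightarrow> torus_periodic n f \<Longrightarrow> (\<Sum>v\<in>torus_vertices n. f v) = 0 \<Longrightarrow>
    (\<Sum>v\<in>torus_vertices n. (cmod (f v))\<^sup>2)
    \<le> K * (displacement n f (\<lambda>v. v + vector [1, 0]) + displacement n f (\<lambda>v. v + vector [0, 1])
       + displacement n f ((*v) (S ** Y)) + displacement n f ((*v) (T ** Y')))"
    using hyperbolic_torus_gap[OF Y(2-4) invertible_mult[OF S invY(1)]] unfolding Y'(2) by metis
  \<comment> \<open>The 20 is 2 + 2 for the two translations plus 8 + 8 for the two products, each a
    composition of two moves.\<close>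
  have "1 / (20 * K) \<le> lambda2 (torus_graph S T n)" if n: "n \<ge> 2" for n
  proof (rule lambda2_ge)
    show "0 \<in> fst (torus_graph S T n)" "vector [1, 0] \<in> fst (torus_graph S T n)"
      using n by (auto simp: torus_vertices_def forall_2)
    show "0 \<noteq> (vector [1, 0] :: int^2)" by (simp add: vec_eq_iff forall_2)
    fix f :: "int^2 \<Rightarrow> complex"
    assume f0: "(\<Sum>u\<in>fst (torus_graph S T n). f u) = 0"
    \<comment> \<open>Only the values of \<open>f\<close> on the vertices matter, so
      \<open>f\<close> is replaced by its periodic extension.\<close>
    let ?f = "\<lambda>v. f (reduce_mod n v)" and ?E = "\<Sum>e\<in>snd (torus_graph S T n). edge_energy f e"
    have per: "torus_periodic n ?f" by (simp add: torus_periodic_def)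
    have move: "displacement n ?f \<phi> \<le> 2 * ?E" if "\<phi> \<in> torus_moves S T" for \<phi>
      by (rule displacement_le_energy[OF that])
    have ST: "displacement n ?f ((*v) Z) \<le> 2 * ?E" if "Z = S \<or> Z = T" for Z
      using that by (intro move) (auto simp: torus_moves_def)
    have "displacement n ?f (\<lambda>v. v + vector [1, 0]) \<le> 2 * ?E"
      "displacement n ?f (\<lambda>v. v + vector [0, 1]) \<le> 2 * ?E"
      by (intro move; simp add: torus_moves_def)+
    moreover have "displacement n ?f ((*v) (S ** Y)) \<le> 8 * ?E"
      using displacement_compose[OF _ invY(1) per, of S] n ST[of S] ST[OF Y(1)] by simp
    moreover have "displacement n ?f ((*v) (T ** Y')) \<le> 8 * ?E"
      using displacement_compose[OF _ invY(2) per, of T] n ST[of T] ST[OF Y'(1)] by simp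
    ultimately have "displacement n ?f (\<lambda>v. v + vector [1, 0]) + displacement n ?f (\<lambda>v. v + vector [0, 1])
       + displacement n ?f ((*v) (S ** Y)) + displacement n ?f ((*v) (T ** Y')) \<le> 20 * ?E"
      by linarith
    then have "K * (displacement n ?f (\<lambda>v. v + vector [1, 0]) + displacement n ?f (\<lambda>v. v + vector [0, 1])
       + displacement n ?f ((*v) (S ** Y)) + displacement n ?f ((*v) (T ** Y'))) \<le> K * (20 * ?E)"
      using K(1) by (intro mult_left_mono) auto
    moreover have "(\<Sum>v\<in>torus_vertices n. (cmod (f v))\<^sup>2)
    \<le> K * (displacement n ?f (\<lambda>v. v + vector [1, 0]) + displacement n ?f (\<lambda>v. v + vector [0, 1])
       + displacement n ?f ((*v) (S ** Y)) + displacement n ?f ((*v) (T ** Y')))"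
      using K(2)[OF _ per] n f0 by simp
    ultimately have "(\<Sum>v\<in>torus_vertices n. (cmod (f v))\<^sup>2) \<le> K * (20 * ?E)" by linarith
    then show "1 / (20 * K) * (\<Sum>u\<in>fst (torus_graph S T n). (cmod (f u))\<^sup>2) \<le> ?E"
      using K(1) by (simp add: field_simps)
  qed simp
  then have "\<exists>c>0. \<forall>n\<in>{2..}. c \<le> lambda2 (torus_graph S T n)"
    using K(1) by (intro exI[of _ "1 / (20 * K)"]) simp
  moreover have "\<exists>D. \<forall>n\<in>{2..}. \<forall>v\<in>fst (torus_graph S T n). ugraph_degree (torus_graph S T n) v \<le> D"
    using ugraph_degree_torus_graph_le[OF _ S T] by (intro exI[of _ 16]) simp
  ultimately show ?thesis
    using finite_ugraph_torus_graph by (simp add: expander_family_def infinite_Ici)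
qed

subsection \<open>Test functions for virtually cyclic groups\<close>

lemma norm_cis_minus_1_le: "cmod (cis t - 1) \<le> \<bar>t\<bar>"
proof -
  have "cmod (cis t - 1) = 2 * \<bar>sin (t / 2)\<bar>"
    using dist_exp_i_1[of t] by (simp add: cis_conv_exp)
  also have "\<dots> \<le> \<bar>t\<bar>"
    using abs_sin_x_le_abs_x[of "t / 2"] by simp
  finally show ?thesis .
qed

lemma Re_mult_Re_torus_char:
  "Re (torus_char n k x) * Re (torus_char n l x)
    = (Re (torus_char n (k + l) x) + Re (torus_char n (k - l) x)) / 2"
proof -
  have "torus_char n (k - l) x = torus_char n k x * cnj (torus_char n l x)"
    by (metis torus_char_diff torus_char_commute)
  then show ?thesis
    by (simp add: torus_char_add_left)
qed

lemma sum_Re_torus_char_nonneg: "n > 0 \<Longrightarrow> 0 \<le> (\<Sum>x\<in>torus_vertices n. Re (torus_char n k x))"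
  by (simp flip: Re_sum add: sum_torus_char)

text \<open>In the expanded square every inner product of two cosines is half a sum of two complete
  character sums, each of which is 0 or \<open>n\<close> squared. So the cross terms are
  nonnegative, and each diagonal term contributes at least half of \<open>n\<close> squared through
  the frequency \<open>k i - k i = 0\<close>.\<close>

lemma sum_square_cosines_ge:
  assumes n: "n > 0" and I: "finite I"
  shows "real (card I) * (real n)\<^sup>2 / 2
    \<le> (\<Sum>x\<in>torus_vertices n. (\<Sum>i\<in>I. Re (torus_char n (k i) x))\<^sup>2)"
proof -
  let ?V = "torus_vertices n"
  let ?c = "\<lambda>i j. \<Sum>x\<in>?V. Re (torus_char n (k i) x) * Re (torus_char n (k j) x)"
  have c: "?c i j = ((\<Sum>x\<in>?V. Re (torus_char n (k i + k j) x)) + (\<Sum>x\<in>?V. Re (torus_char n (k i - k j) x))) / 2"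
    for i j
    by (simp add: Re_mult_Re_torus_char sum.distrib flip: sum_divide_distrib)
  have nonneg: "?c i j \<ge> 0" for i j
    unfolding c using sum_Re_torus_char_nonneg[OF n] by (simp add: add_nonneg_nonneg)
  have diag: "(real n)\<^sup>2 / 2 \<le> ?c i i" for i
    unfolding c using sum_Re_torus_char_nonneg[OF n, of "k i + k i"] by (simp add: card_torus_vertices)
  have "real (card I) * (real n)\<^sup>2 / 2 = (\<Sum>i\<in>I. (real n)\<^sup>2 / 2)" by simp
  also have "\<dots> \<le> (\<Sum>i\<in>I. \<Sum>j\<in>I. ?c i j)"
  proof (rule sum_mono)
    fix i assume "i \<in> I"
    have "(real n)\<^sup>2 / 2 \<le> ?c i i" by (rule diag)
    also have "\<dots> \<le> (\<Sum>j\<in>I. ?c i j)"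
      by (rule member_le_sum) (use I \<open>i \<in> I\<close> nonneg in auto)
    finally show "(real n)\<^sup>2 / 2 \<le> (\<Sum>j\<in>I. ?c i j)" .
  qed
  also have "\<dots> = (\<Sum>i\<in>I. \<Sum>x\<in>?V. \<Sum>j\<in>I. Re (torus_char n (k i) x) * Re (torus_char n (k j) x))"
    by (intro sum.cong refl sum.swap)
  also have "\<dots> = (\<Sum>x\<in>?V. \<Sum>i\<in>I. \<Sum>j\<in>I. Re (torus_char n (k i) x) * Re (torus_char n (k j) x))"
    by (rule sum.swap)
  finally show ?thesis
    by (simp add: power2_eq_square sum_product)
qed

text \<open>The test function is the sum of the \<^term>\<open>P i\<close>-translates of \<open>x \<mapsto> cos (2 * pi * x\<^sub>1 / n)\<close>.
  Its norm grows with the number of translates even when some of them coincide, because the inner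
  product of two of them is never negative.\<close>

lemma lambda2_small:
  fixes S T :: "int^2^2" and P :: "'i \<Rightarrow> int^2^2"
  assumes S: "invertible S" and T: "invertible T"
    and I: "finite I" "I \<noteq> {}" and P: "\<And>i. i \<in> I \<Longrightarrow> invertible (P i)"
    and almost: "\<And>(h :: int^2 \<Rightarrow> real) X v. (\<And>v. h (- v) = h v) \<Longrightarrow> (\<And>v. \<bar>h v\<bar> \<le> 1) \<Longrightarrow> X \<in> {S, T} \<Longrightarrow>
      \<bar>(\<Sum>i\<in>I. h (P i *v (X *v v))) - (\<Sum>i\<in>I. h (P i *v v))\<bar> \<le> 4"
  shows "\<exists>n\<ge>2. lambda2 (torus_graph S T n) \<le> 256 / real (card I)"
proof -
  let ?u = "vector [1, 0] :: int^2"
  have card: "real (card I) > 0" using I by (simp add: card_gt_0_iff)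
  \<comment> \<open>The frequency of the translated wave: precomposition with \<open>P i\<close> is
    absorbed by the transpose.\<close>
  define k where "k = (\<lambda>i. transpose (P i) *v ?u)"
  define C where "C = (\<Sum>i\<in>I. 2 * pi * real_of_int (\<bar>k i $ 1\<bar> + \<bar>k i $ 2\<bar>))"
  have C0: "C \<ge> 0" by (simp add: C_def sum_nonneg)
  \<comment> \<open>The modulus is chosen after the translates, so large that a unit shift changes
    their sum by at most \<open>C / n\<close>, which is at most 1.\<close>
  define n where "n = nat \<lceil>C\<rceil> + 2"
  have n: "n \<ge> 2" "n > 0" "C \<le> real n"
    by (simp_all add: n_def) linarith
  let ?V = "torus_vertices n"
  define h where "h = (\<lambda>v. Re (torus_char n ?u v))"
  have hP: "h (P i *v v) = Re (torus_char n (k i) v)" for i v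
    unfolding h_def k_def torus_char_mult ..
  define g where "g = (\<lambda>v. \<Sum>i\<in>I. h (P i *v v))"
  have g: "g v = (\<Sum>i\<in>I. Re (torus_char n (k i) v))" for v
    by (simp add: g_def hP)
  define f where "f = (\<lambda>v. complex_of_real (g v))"
  have hper: "torus_periodic n h"
    using torus_periodic_char[OF n(2), of ?u] by (simp add: h_def torus_periodic_def)
  have gper: "torus_periodic n g"
    unfolding g_def torus_periodic_def
    using torus_periodicD[OF torus_periodic_mult[OF hper]] by simp
  have fper: "torus_periodic n f"
    using gper by (simp add: f_def torus_periodic_def)
  \<comment> \<open>The wave has mean zero because its frequency is nonzero modulo \<open>n\<close>
    for \<open>n \<ge> 2\<close>.\<close>
  have h_sum: "(\<Sum>v\<in>?V. h v) = 0"
    using n(1) by (simp add: h_def sum_torus_char vec_eq_iff forall_2 flip: Re_sum)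
  have "(\<Sum>v\<in>?V. g v) = (\<Sum>i\<in>I. \<Sum>v\<in>?V. h (P i *v v))"
    unfolding g_def by (rule sum.swap)
  also have "\<dots> = 0"
    using sum_torus_mult[OF n(2) P hper] by (simp add: h_sum)
  finally have f_sum: "(\<Sum>v\<in>?V. f v) = 0"
    by (simp add: f_def flip: of_real_sum)
  have norm: "real (card I) * (real n)\<^sup>2 / 2 \<le> (\<Sum>v\<in>?V. (cmod (f v))\<^sup>2)"
    unfolding f_def norm_of_real power2_abs g by (rule sum_square_cosines_ge[OF n(2) I(1)])
  then have norm_pos: "0 < (\<Sum>v\<in>?V. (cmod (f v))\<^sup>2)"
    using card n(2) by (intro less_le_trans[OF _ norm]) simp
  then obtain u where u: "u \<in> ?V" "f u \<noteq> 0"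
    by (metis (no_types, lifting) less_irrefl norm_zero sum.neutral zero_power2)
  have shift: "\<bar>g (v + w) - g v\<bar> \<le> 4" if w: "\<bar>w $ 1\<bar> \<le> 1" "\<bar>w $ 2\<bar> \<le> 1" for v w
  proof -
    have "\<bar>g (v + w) - g v\<bar> \<le> (\<Sum>i\<in>I. \<bar>Re (torus_char n (k i) (v + w)) - Re (torus_char n (k i) v)\<bar>)"
      unfolding g by (simp flip: sum_subtractf)
    also have "\<dots> \<le> (\<Sum>i\<in>I. 2 * pi * real_of_int (\<bar>k i $ 1\<bar> + \<bar>k i $ 2\<bar>) / real n)"
    proof (rule sum_mono)
      fix i
      let ?m = "k i $ 1 * w $ 1 + k i $ 2 * w $ 2"
      have "\<bar>?m\<bar> \<le> \<bar>k i $ 1\<bar> * \<bar>w $ 1\<bar> + \<bar>k i $ 2\<bar> * \<bar>w $ 2\<bar>"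
        by (rule order_trans[OF abs_triangle_ineq]) (simp add: abs_mult)
      also have "\<dots> \<le> \<bar>k i $ 1\<bar> * 1 + \<bar>k i $ 2\<bar> * 1"
        using w by (intro add_mono mult_left_mono) auto
      finally have m: "real_of_int \<bar>?m\<bar> \<le> real_of_int (\<bar>k i $ 1\<bar> + \<bar>k i $ 2\<bar>)"
        unfolding of_int_le_iff by simp
      have "\<bar>Re (torus_char n (k i) (v + w)) - Re (torus_char n (k i) v)\<bar>
          \<le> cmod (torus_char n (k i) (v + w) - torus_char n (k i) v)"
        using abs_Re_le_cmod[of "torus_char n (k i) (v + w) - torus_char n (k i) v"] by simp
      also have "torus_char n (k i) (v + w) - torus_char n (k i) v
          = torus_char n (k i) v * (torus_char n (k i) w - 1)"
        by (simp add: torus_char_add algebra_simps)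
      also have "cmod \<dots> = cmod (torus_char n (k i) w - 1)"
        by (simp add: norm_mult)
      also have "\<dots> \<le> \<bar>2 * pi * real_of_int ?m / real n\<bar>"
        unfolding torus_char_def by (rule norm_cis_minus_1_le)
      also have "\<dots> = 2 * pi * real_of_int \<bar>?m\<bar> / real n"
        by (simp only: abs_divide abs_mult of_int_abs) simp
      also have "\<dots> \<le> 2 * pi * real_of_int (\<bar>k i $ 1\<bar> + \<bar>k i $ 2\<bar>) / real n"
        using m by (intro divide_right_mono mult_left_mono) auto
      finally show "\<bar>Re (torus_char n (k i) (v + w)) - Re (torus_char n (k i) v)\<bar>
          \<le> 2 * pi * real_of_int (\<bar>k i $ 1\<bar> + \<bar>k i $ 2\<bar>) / real n" .
    qed
    also have "\<dots> = C / real n"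
      by (simp add: C_def sum_divide_distrib)
    also have "\<dots> \<le> 4"
      using n C0 by (simp add: field_simps)
    finally show ?thesis .
  qed
  have X: "\<bar>g (Y *v v) - g v\<bar> \<le> 4" if "Y \<in> {S, T}" for Y v
    unfolding g_def
  proof (rule almost[OF _ _ that])
    show "h (- v) = h v" for v
      unfolding h_def cnj_torus_char[symmetric] by simp
    show "\<bar>h v\<bar> \<le> 1" for v
      using abs_Re_le_cmod[of "torus_char n ?u v"] by (simp add: h_def)
  qed
  have inverse: "\<bar>g (matrix_inv Y *v v) - g v\<bar> \<le> 4" if "Y \<in> {S, T}" for Y v
  proof -
    have "Y *v (matrix_inv Y *v v) = v"
      using that S T by (auto simp: matrix_vector_mul_assoc matrix_inv_mult)
    then show ?thesis
      using X[OF that, of "matrix_inv Y *v v"] by simp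
  qed
  have moves: "\<bar>g (\<phi> v) - g v\<bar> \<le> 4" if "\<phi> \<in> torus_moves S T" for \<phi> v
    using that X[of S v] X[of T v] inverse[of S v] inverse[of T v]
      shift[of "vector [1, 0]" v] shift[of "- vector [1, 0]" v]
      shift[of "vector [0, 1]" v] shift[of "- vector [0, 1]" v]
    by (auto simp: torus_moves_def)
  have disp: "displacement n f \<phi> \<le> 16 * (real n)\<^sup>2" if "\<phi> \<in> torus_moves S T" for \<phi>
  proof -
    have "displacement n f \<phi> \<le> (\<Sum>v\<in>?V. 4\<^sup>2)"
      unfolding displacement_def
    proof (rule sum_mono)
      fix v
      have "cmod (f (\<phi> v) - f v) \<le> 4"
        using moves[OF that, of v] by (simp add: f_def flip: of_real_diff)
      then show "(cmod (f (\<phi> v) - f v))\<^sup>2 \<le> 4\<^sup>2"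
        by (intro power_mono) auto
    qed
    then show ?thesis by (simp add: card_torus_vertices)
  qed
  \<comment> \<open>At most eight moves, each changing the test function by at most 4 at every
    vertex, give the 128; the lower bound on the norm supplies another factor 2.\<close>
  have "(\<Sum>e\<in>snd (torus_graph S T n). edge_energy f e) \<le> (\<Sum>\<phi>\<in>torus_moves S T. displacement n f \<phi>)"
    by (rule energy_le_displacements[OF fper])
  also have "\<dots> \<le> real (card (torus_moves S T)) * (16 * (real n)\<^sup>2)"
    using disp by (rule sum_bounded_above)
  also have "\<dots> \<le> 8 * (16 * (real n)\<^sup>2)"
    using card_torus_moves[of S T] by (intro mult_right_mono) auto
  finally have energy: "(\<Sum>e\<in>snd (torus_graph S T n). edge_energy f e) \<le> 128 * (real n)\<^sup>2" by simp
  have "lambda2 (torus_graph S T n) \<le> (\<Sum>e\<in>snd (torus_graph S T n). edge_energy f e) / (\<Sum>v\<in>?V. (cmod (f v))\<^sup>2)"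
    using lambda2_le[of u "torus_graph S T n" f] u f_sum by simp
  also have "\<dots> \<le> 128 * (real n)\<^sup>2 / (\<Sum>v\<in>?V. (cmod (f v))\<^sup>2)"
    using energy norm_pos by (intro divide_right_mono) auto
  also have "\<dots> \<le> 128 * (real n)\<^sup>2 / (real (card I) * (real n)\<^sup>2 / 2)"
    using norm norm_pos card n(2) by (intro divide_left_mono mult_pos_pos divide_pos_pos) auto
  also have "\<dots> = 256 / real (card I)"
    using n(2) card by (simp add: field_simps)
  finally show ?thesis using n(1) by blast
qed

section \<open>Waves averaged along cyclic and dihedral orbits\<close>

lemma not_expander_torus_graph:
  assumes "\<And>m. m > 0 \<Longrightarrow> \<exists>n\<ge>2. lambda2 (torus_graph S T n) \<le> 256 / real m"
  shows "\<not> expander_family {2..} (torus_graph S T)"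
proof
  assume "expander_family {2..} (torus_graph S T)"
  then obtain c where c: "c > 0" "\<And>n. n \<ge> 2 \<Longrightarrow> c \<le> lambda2 (torus_graph S T n)"
    by (auto simp: expander_family_def)
  define m where "m = nat \<lceil>256 / c\<rceil> + 1"
  have m: "m > 0" "256 / c < real m" by (simp_all add: m_def) linarith
  then have "256 / real m < c" using c(1) by (simp add: field_simps)
  with assms[OF m(1)] c(2) show False by fastforce
qed

text \<open>Factors are added on the right, so that precomposition with \<open>M\<close> raises the
  exponent and sums over powers telescope.\<close>

definition matrix_pow :: "int^2^2 \<Rightarrow> nat \<Rightarrow> int^2^2" where
  "matrix_pow M j = ((\<lambda>X. X ** M) ^^ j) (mat 1)"

lemma matrix_pow_0 [simp]: "matrix_pow M 0 = mat 1"
  by (simp add: matrix_pow_def)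

lemma matrix_pow_Suc_vector: "matrix_pow M j *v (M *v v) = matrix_pow M (Suc j) *v v"
  by (simp add: matrix_pow_def matrix_vector_mul_assoc)

lemma invertible_matrix_pow: "invertible M \<Longrightarrow> invertible (matrix_pow M j)"
  by (induction j) (auto simp: matrix_pow_def invertible_mult invertible_def[of "mat 1"])

lemma matrix_vector_mult_minus: "M *v (- v) = - (M *v v)" for M :: "int^2^2"
  by (simp add: vec_eq_iff matrix_vector_mult_2)

text \<open>Averaging over the first \<open>m\<close> powers of \<open>S\<close> makes the effect of
  \<open>S\<close> telescope to two boundary terms. Up to a sign, invisible to even functions,
  \<open>T\<close> is the inverse of \<open>S\<close>, so its effect is that of \<open>S\<close>
  read backwards.\<close>

lemma not_expander_antisymmetric:
  fixes S T :: "int^2^2"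
  assumes inv: "invertible S" "invertible T" and ST: "\<And>v. S *v (T *v v) = v \<or> S *v (T *v v) = - v"
  shows "\<not> expander_family {2..} (torus_graph S T)"
proof (rule not_expander_torus_graph)
  fix m :: nat assume "m > 0"
  have "\<exists>n\<ge>2. lambda2 (torus_graph S T n) \<le> 256 / real (card {..<m})"
  proof (rule lambda2_small[OF inv])
    show "{..<m} \<noteq> {}" using \<open>m > 0\<close> by auto
    show "invertible (matrix_pow S i)" for i by (rule invertible_matrix_pow[OF inv(1)])
    fix h :: "int^2 \<Rightarrow> real" and X v
    assume even: "\<And>v. h (- v) = h v" and h1: "\<And>v. \<bar>h v\<bar> \<le> 1" and X: "X \<in> {S, T}"
    define g where "g = (\<lambda>v. \<Sum>i<m. h (matrix_pow S i *v v))"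
    have gS: "\<bar>g (S *v v) - g v\<bar> \<le> 2" for v
    proof -
      have "g (S *v v) - g v = (\<Sum>i<m. h (matrix_pow S (Suc i) *v v) - h (matrix_pow S i *v v))"
        by (simp add: g_def matrix_pow_Suc_vector sum_subtractf)
      also have "\<dots> = h (matrix_pow S m *v v) - h (matrix_pow S 0 *v v)"
        by (rule sum_lessThan_telescope)
      finally show ?thesis
        using h1[of "matrix_pow S m *v v"] h1[of "matrix_pow S 0 *v v"] by linarith
    qed
    have "g (- v) = g v" for v
      by (simp add: g_def matrix_vector_mult_minus even)
    then have "g (S *v (T *v v)) = g v" using ST[of v] by auto
    then have "\<bar>g (T *v v) - g v\<bar> \<le> 2" using gS[of "T *v v"] by simp
    then show "\<bar>(\<Sum>i<m. h (matrix_pow S i *v (X *v v))) - (\<Sum>i<m. h (matrix_pow S i *v v))\<bar> \<le> 4"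
      using X gS[of v] by (auto simp: g_def)
  qed simp
  then show "\<exists>n\<ge>2. lambda2 (torus_graph S T n) \<le> 256 / real m" by simp
qed

text \<open>Up to sign \<open>S\<close> and \<open>T\<close> generate a dihedral group. The average
  runs over the powers of \<open>T ** S\<close> with exponent below \<open>m\<close>, with and
  without a further factor \<open>S\<close> on the right. Applying \<open>S\<close> interchanges the
  two halves, while \<open>T\<close> shifts along the group and changes only the ends.\<close>

lemma not_expander_involutions:
  fixes S T :: "int^2^2"
  assumes inv: "invertible S" "invertible T"
    and SS: "\<And>v. S *v (S *v v) = v \<or> S *v (S *v v) = - v"
    and TT: "\<And>v. T *v (T *v v) = v \<or> T *v (T *v v) = - v"
  shows "\<not> expander_family {2..} (torus_graph S T)"
proof (rule not_expander_torus_graph)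
  fix m :: nat assume "m > 0"
  define W where "W = matrix_pow (T ** S)"
  define P where "P = (\<lambda>(i, b). if b then W i ** S else W i)"
  let ?I = "{..<m} \<times> (UNIV :: bool set)"
  have W: "invertible (W i)" for i
    unfolding W_def by (intro invertible_matrix_pow invertible_mult inv)
  have "\<exists>n\<ge>2. lambda2 (torus_graph S T n) \<le> 256 / real (card ?I)"
  proof (rule lambda2_small[OF inv])
    show "?I \<noteq> {}" using \<open>m > 0\<close> by auto
    show "invertible (P i)" for i
      using W inv by (auto simp: P_def invertible_mult split: prod.split)
    fix h :: "int^2 \<Rightarrow> real" and X v
    assume even: "\<And>v. h (- v) = h v" and h1: "\<And>v. \<bar>h v\<bar> \<le> 1" and X: "X \<in> {S, T}"
    have g: "(\<Sum>i\<in>?I. h (P i *v v)) = (\<Sum>i<m. h (W i *v v)) + (\<Sum>i<m. h (W i *v (S *v v)))" for v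
    proof -
      have "(\<Sum>i\<in>?I. h (P i *v v)) = (\<Sum>i<m. \<Sum>b\<in>UNIV. h (P (i, b) *v v))"
        by (simp add: sum.cartesian_product case_prod_unfold)
      then show ?thesis
        by (simp add: P_def UNIV_bool sum.distrib matrix_vector_mul_assoc)
    qed
    have W_Suc: "W i *v (T *v (S *v v)) = W (Suc i) *v v" for i v
      unfolding W_def matrix_vector_mul_assoc[of T] by (rule matrix_pow_Suc_vector)
    have hSS: "h (L *v (S *v (S *v v))) = h (L *v v)" for L v
      using SS[of v] by (auto simp: matrix_vector_mult_minus even)
    have hTT: "h (L *v (T *v (T *v v))) = h (L *v v)" for L v
      using TT[of v] by (auto simp: matrix_vector_mult_minus even)
    have S_move: "(\<Sum>i\<in>?I. h (P i *v (S *v v))) = (\<Sum>i\<in>?I. h (P i *v v))"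
      unfolding g hSS by simp
    \<comment> \<open>Applying \<open>T\<close> turns the unmarked terms into \<open>p\<close>
      advanced by one and the terms with factor \<open>S\<close> into \<open>q\<close>; the original
      sum consists of \<open>q\<close> advanced by one and \<open>p\<close>. The difference
      telescopes to four boundary values.\<close>
    define p q where "p = (\<lambda>i. h (W i *v (S *v v)))" and "q = (\<lambda>i. h (W i *v (S *v (T *v v))))"
    have "h (W i *v (T *v v)) = p (Suc i)" for i
    proof -
      have "p (Suc i) = h ((W i ** T) *v (S *v (S *v v)))"
        by (simp add: p_def matrix_vector_mul_assoc[of "W i" T, symmetric] flip: W_Suc)
      also have "\<dots> = h ((W i ** T) *v v)" by (rule hSS)
      finally show ?thesis by (simp only: matrix_vector_mul_assoc)
    qed
    moreover have "h (W i *v v) = q (Suc i)" for i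
    proof -
      have "q (Suc i) = h ((W i ** T) *v (S *v (S *v (T *v v))))"
        by (simp add: q_def matrix_vector_mul_assoc[of "W i" T, symmetric] flip: W_Suc)
      also have "\<dots> = h (W i *v (T *v (T *v v)))"
        by (simp only: hSS matrix_vector_mul_assoc[of "W i" T])
      finally show ?thesis by (simp only: hTT)
    qed
    ultimately have "(\<Sum>i\<in>?I. h (P i *v (T *v v))) - (\<Sum>i\<in>?I. h (P i *v v))
        = (\<Sum>i<m. p (Suc i) - p i) - (\<Sum>i<m. q (Suc i) - q i)"
      unfolding g by (simp add: p_def q_def sum_subtractf)
    also have "\<dots> = p m - p 0 - (q m - q 0)"
      by (simp only: sum_lessThan_telescope)
    finally have "\<bar>(\<Sum>i\<in>?I. h (P i *v (T *v v))) - (\<Sum>i\<in>?I. h (P i *v v))\<bar> \<le> 4"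
      using h1[of "W m *v (S *v v)"] h1[of "W 0 *v (S *v v)"]
        h1[of "W m *v (S *v (T *v v))"] h1[of "W 0 *v (S *v (T *v v))"]
      unfolding p_def q_def by linarith
    then show "\<bar>(\<Sum>i\<in>?I. h (P i *v (X *v v))) - (\<Sum>i\<in>?I. h (P i *v v))\<bar> \<le> 4"
      using X S_move by auto
  qed simp
  then obtain n where n: "n \<ge> 2" "lambda2 (torus_graph S T n) \<le> 256 / real (card ?I)" by blast
  have "256 / real (card ?I) \<le> 256 / real m"
    using \<open>m > 0\<close> by (simp add: card_cartesian_product field_simps)
  with n show "\<exists>n\<ge>2. lambda2 (torus_graph S T n) \<le> 256 / real m" by fastforce
qed

theorem theorem1p3:
  fixes a b c d :: int and R S :: "int^2^2"
  assumes R: "R = vector [vector [0, 1], vector [1, 0]]"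
    and S: "S = vector [vector [a, b], vector [c, d]]"
    and GL: "invertible S"
  shows "expander_family {2..} (torus_graph S (R ** S ** R)) \<longleftrightarrow> (a + d) * (b + c) \<noteq> 0"
proof
  have nth: "S $ 1 $ 1 = a" "S $ 1 $ 2 = b" "S $ 2 $ 1 = c" "S $ 2 $ 2 = d"
    by (simp_all add: S)
  {
    assume "(a + d) * (b + c) \<noteq> 0"
    then show "expander_family {2..} (torus_graph S (R ** S ** R))"
      unfolding R using expander_torus_graph[OF GL] by (simp add: nth)
  next
    assume exp: "expander_family {2..} (torus_graph S (R ** S ** R))"
    define T where "T = R ** S ** R"
    have T: "invertible T"
      unfolding T_def R by (intro invertible_mult invertible_coord_swap GL)
    have T_nth: "T $ 1 $ 1 = d" "T $ 1 $ 2 = c" "T $ 2 $ 1 = b" "T $ 2 $ 2 = a"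
      by (simp_all only: T_def R coord_swap_conjugate nth)
    define \<delta> where "\<delta> = a * d - b * c"
    have \<delta>: "\<delta> = 1 \<or> \<delta> = - 1"
      using det_invertible_int[OF GL] by (simp add: \<delta>_def det_2 nth)
    show "(a + d) * (b + c) \<noteq> 0"
    proof
      assume "(a + d) * (b + c) = 0"
      then consider "d = - a" | "c = - b" by (auto simp: eq_neg_iff_add_eq_0 add.commute)
      then have "\<not> expander_family {2..} (torus_graph S T)"
      proof cases
        case 1
        \<comment> \<open>Cayley-Hamilton with trace 0: the square of \<open>S\<close> is
          \<open>- \<delta>\<close> times the identity. The matrix \<open>T\<close> has the same
          trace and determinant.\<close>
        have "S *v (S *v v) = v \<or> S *v (S *v v) = - v" for v
        proof -
          have "(S *v (S *v v)) $ i = - \<delta> * v $ i" for i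
            using exhaust_2[of i] by (auto simp: matrix_vector_mult_2 nth 1 \<delta>_def algebra_simps)
          then show ?thesis using \<delta> by (auto simp: vec_eq_iff)
        qed
        moreover have "T *v (T *v v) = v \<or> T *v (T *v v) = - v" for v
        proof -
          have "(T *v (T *v v)) $ i = - \<delta> * v $ i" for i
            using exhaust_2[of i] by (auto simp: matrix_vector_mult_2 T_nth 1 \<delta>_def algebra_simps)
          then show ?thesis using \<delta> by (auto simp: vec_eq_iff)
        qed
        ultimately show ?thesis
          by (rule not_expander_involutions[OF GL T])
      next
        case 2
        \<comment> \<open>For \<open>c = - b\<close> the matrix \<open>T\<close> is the adjugate of
          \<open>S\<close>, so the product is \<open>\<delta>\<close> times the identity.\<close>
        have "S *v (T *v v) = v \<or> S *v (T *v v) = - v" for v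
        proof -
          have "(S *v (T *v v)) $ i = \<delta> * v $ i" for i
            using exhaust_2[of i] by (auto simp: matrix_vector_mult_2 nth T_nth 2 \<delta>_def algebra_simps)
          then show ?thesis using \<delta> by (auto simp: vec_eq_iff)
        qed
        then show ?thesis
          by (rule not_expander_antisymmetric[OF GL T])
      qed
      with exp show False by (simp add: T_def)
    qed
  }
qed

end
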